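(* Let $p\in\mathbb{N}$, let $z_0=a+ib$ with $-\infty<a<\infty$ and $b>0$, and let $f_p(x)=(x-z_0)^{-p}$. Let $\operatorname{R}_n[f_p]$ be the remainder when using the $n$-point Gauss-Legendre rule to compute $\int_{-1}^1 f_p(x)\,\mathrm{d}x$. Then, in the asymptotic limit $n\to\infty$, $$|\operatorname{R}_n[f_p]| \simeq \frac{2\pi}{(p-1)!}\left|\frac{2n+1}{\sqrt{z_0^2-1}}\right|^{p-1}\frac{1}{\left|z_0+\sqrt{z_0^2-1}\right|^{2n+1}}.$$
   Context: $\mathbb{N}=\{1,2,3,\dots\}$. The notation $a(n)\simeq b(n)$ means asymptotically equal: $\lim_{n\to\infty} a(n)/b(n)=1$. The $n$-point Gauss-Legendre rule on $[-1,1]$ is $\operatorname{Q}_n[f]=\sum_{i=1}^n f(x_i)w_i$, where $x_1<\dots<x_n$ are the roots of the Legendre polynomial $P_n$ of degree $n$ and $w_i=\frac{2}{(1-x_i^2)P_n'(x_i)^2}$. The remainder is $\operatorname{R}_n[f]=\int_{-1}^1 f(x)\,\mathrm{d}x-\operatorname{Q}_n[f]$. The square root $\sqrt{z^2-1}$ for $z\in\mathbb{C}\setminus[-1,1]$ denotes the branch analytic on $\mathbb{C}\setminus[-1,1]$ for which $|z+\sqrt{z^2-1}|>1$ (equivalently $\sqrt{z^2-1}\sim z$ as $|z|\to\infty$). *)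

theory Defs
  imports "HOL-Analysis.Analysis" "HOL-Library.Landau_Symbols"
    "HOL-Computational_Algebra.Polynomial"
begin

text \<open>Legendre polynomials by Rodrigues' formula.\<close>

definition legendre :: "nat \<Rightarrow> real poly" where
  "legendre n = smult (1 / (2 ^ n * fact n)) ((pderiv ^^ n) ([:-1, 0, 1:] ^ n))"

definition gl_weight :: "nat \<Rightarrow> real \<Rightarrow> real" where
  "gl_weight n x = 2 / ((1 - x\<^sup>2) * (poly (pderiv (legendre n)) x)\<^sup>2)"

definition gl_rule :: "nat \<Rightarrow> (real \<Rightarrow> complex) \<Rightarrow> complex" where
  "gl_rule n f = (\<Sum>x | poly (legendre n) x = 0. f x * of_real (gl_weight n x))"

definition gl_remainder :: "nat \<Rightarrow> (real \<Rightarrow> complex) \<Rightarrow> complex" where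
  "gl_remainder n f = integral {-1..1} f - gl_rule n f"

text \<open>
  The branch of the square root of \<open>z\<^sup>2 - 1\<close> on the complement of the segment \<open>[-1, 1]\<close>.
  The lemma \<open>ex1_sqrt_branch\<close> below shows that the description determines the value; inside
  the segment the value is unspecified.
\<close>

definition sqrt_branch :: "complex \<Rightarrow> complex" where
  "sqrt_branch z = (THE w. w\<^sup>2 = z\<^sup>2 - 1 \<and> norm (z + w) > 1)"

lemma norm_plus_eq_1_imp_segment:
  fixes z w :: complex
  assumes "w\<^sup>2 = z\<^sup>2 - 1" "norm (z + w) = 1"
  shows "z \<in> complex_of_real ` {-1..1}"
proof -
  have prod: "(z + w) * (z - w) = 1"
    using assms(1) by (simp add: algebra_simps power2_eq_square)
  have "(z + w) * cnj (z + w) = 1"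
    using complex_norm_square[of "z + w"] assms(2) by simp
  with prod have "(z + w) * (z - w) = (z + w) * cnj (z + w)" by simp
  moreover have "z + w \<noteq> 0" using assms(2) by auto
  ultimately have "z - w = cnj (z + w)" by (simp only: mult_cancel_left) auto
  hence "2 * z = (z + w) + cnj (z + w)" by (simp add: algebra_simps)
  also have "\<dots> = of_real (2 * Re (z + w))" by (simp only: complex_add_cnj)
  finally have "z = of_real (Re (z + w))" by (simp add: complex_eq_iff)
  moreover have "\<bar>Re (z + w)\<bar> \<le> 1" using abs_Re_le_cmod[of "z + w"] assms(2) by simp
  ultimately show ?thesis by (metis abs_le_iff atLeastAtMost_iff image_eqI minus_le_iff)
qed

lemma ex1_sqrt_branch:
  assumes "z \<notin> complex_of_real ` {-1..1}"
  shows "\<exists>!w. w\<^sup>2 = z\<^sup>2 - 1 \<and> norm (z + w) > 1"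
proof (rule ex_ex1I)
  define s where "s = csqrt (z\<^sup>2 - 1)"
  have s: "s\<^sup>2 = z\<^sup>2 - 1" by (simp add: s_def)
  have "(z + s) * (z - s) = 1" using s by (simp add: algebra_simps power2_eq_square)
  hence n: "norm (z + s) * norm (z - s) = 1" by (metis norm_mult norm_one)
  have ne: "norm (z + s) \<noteq> 1" using norm_plus_eq_1_imp_segment[OF s] assms by blast
  show "\<exists>w. w\<^sup>2 = z\<^sup>2 - 1 \<and> norm (z + w) > 1"
  proof (cases "norm (z + s) > 1")
    case True
    with s show ?thesis by blast
  next
    case False
    with ne have l: "norm (z + s) < 1" by simp
    have "norm (z - s) > 1"
    proof (rule ccontr)
      assume "\<not> norm (z - s) > 1"
      hence "norm (z + s) * norm (z - s) \<le> norm (z + s) * 1"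
        by (intro mult_left_mono) auto
      with n l show False by simp
    qed
    with s have "(- s)\<^sup>2 = z\<^sup>2 - 1 \<and> norm (z + (- s)) > 1" by simp
    thus ?thesis by blast
  qed
next
  fix v w
  assume v: "v\<^sup>2 = z\<^sup>2 - 1 \<and> norm (z + v) > 1" and w: "w\<^sup>2 = z\<^sup>2 - 1 \<and> norm (z + w) > 1"
  show "v = w"
  proof (rule ccontr)
    assume "v \<noteq> w"
    moreover have "v\<^sup>2 = w\<^sup>2" using v w by simp
    ultimately have "w = - v" by (auto simp: power2_eq_iff)
    hence "(z + v) * (z + w) = 1" using v by (simp add: algebra_simps power2_eq_square)
    hence "norm (z + v) * norm (z + w) = 1" by (metis norm_mult norm_one)
    moreover have "norm (z + v) * norm (z + w) > 1"
      using v w by (simp add: less_1_mult)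
    ultimately show False by simp
  qed
qed

lemma sqrt_branch:
  assumes "z \<notin> complex_of_real ` {-1..1}"
  shows "(sqrt_branch z)\<^sup>2 = z\<^sup>2 - 1" "norm (z + sqrt_branch z) > 1"
  using theI'[OF ex1_sqrt_branch[OF assms]] by (simp_all add: sqrt_branch_def)

end

theory Submission
  imports Defs "HOL-Complex_Analysis.Complex_Analysis" "HOL-Real_Asymp.Real_Asymp"
    "HOL-Computational_Algebra.Fundamental_Theorem_Algebra"
begin

text \<open>
  Write \<open>P\<^sub>n\<close> for the Legendre polynomials and, for \<open>z\<close> in the upper half-plane, \<open>u = z + \<surd>(z\<^sup>2 - 1)\<close>, so that
  \<open>\<bar>u\<bar> > 1\<close> and \<open>z = (u + 1/u) / 2\<close>. The case \<open>p = 1\<close> is settled first, locally uniformly in \<open>z\<close>; since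
  \<open>(x - z) ^ (- p)\<close> is up to a factor \<open>(p - 1)!\<close> the derivative of order \<open>p - 1\<close> of \<open>1 / (x - z)\<close> with respect
  to \<open>z\<close>, the general case follows by differentiating the asymptotic formula.

  For \<open>p = 1\<close>, let \<open>K\<^sub>n(z)\<close> be the remainder of the rule for \<open>x \<mapsto> 1 / (z - x)\<close>. The rule applied to this
  kernel is the rational function \<open>W\<^sub>n / P\<^sub>n\<close>, where \<open>W\<^sub>n\<close> solves the recurrence of the Legendre polynomials
  with \<open>W\<^sub>0 = 0\<close> and \<open>W\<^sub>1 = 2\<close> (\<open>gl_rule_stieltjes\<close>): both sides have the same poles and, because the Casoratian
  of the two solutions is explicit, the same residues. The same Casoratian gives
  \<open>K\<^sub>n - K\<^sub>n\<^sub>+\<^sub>1 = 2 / ((n + 1) P\<^sub>n P\<^sub>n\<^sub>+\<^sub>1)\<close> (\<open>cauchy_rem_step\<close>), and as \<open>K\<^sub>n \<rightarrow> 0\<close>, the remainder is the sum of these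
  differences. So only the growth of \<open>P\<^sub>n(z)\<close> matters.

  With \<open>g\<^sub>k = binomial (2 k) k / 4 ^ k\<close>, the generating function
  \<open>(1 - 2 z t + t\<^sup>2) powr (-1/2) = (1 - u t) powr (-1/2) * (1 - t / u) powr (-1/2)\<close> shows that
  \<open>P\<^sub>n(z) = u ^ n * (\<Sum>k\<le>n. g\<^sub>k g\<^sub>n\<^sub>-\<^sub>k u ^ (-2 k))\<close> (\<open>leg_expansion\<close>). The inequality \<open>g\<^sub>k g\<^sub>l \<le> g\<^sub>k\<^sub>+\<^sub>l\<close> dominates the terms
  after division by \<open>g\<^sub>n\<close>, hence \<open>P\<^sub>n(z) / (g\<^sub>n u ^ n)\<close> tends to \<open>\<Sum>k. g\<^sub>k u ^ (-2 k)\<close>, whose square is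
  \<open>1 / (1 - u ^ (-2))\<close> (\<open>leg_scaled_uniform_limit\<close>, \<open>cbin_series_square\<close>). Wallis' product gives
  \<open>(n + 1) g\<^sub>n g\<^sub>n\<^sub>+\<^sub>1 \<rightarrow> 1 / \<pi>\<close>, and summing a geometric series yields \<open>K\<^sub>n(z) u ^ (2 n + 1) \<rightarrow> 2 \<pi>\<close>, uniformly on every
  set on which \<open>\<bar>u\<bar>\<close> stays away from \<open>1\<close> (\<open>cauchy_rem_uniform_limit\<close>).

  For \<open>p > 1\<close>, note \<open>du/dz = u / \<surd>(z\<^sup>2 - 1)\<close>. By Cauchy's estimate, differentiating a locally uniformly convergent
  sequence of holomorphic functions and dividing by \<open>2 n + 1\<close> gives a null sequence. Hence each derivative of
  \<open>K\<^sub>n = h\<^sub>n * u ^ (- (2 n + 1))\<close> falls, to leading order, on the power of \<open>u\<close> and contributes a factor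
  \<open>- (2 n + 1) / \<surd>(z\<^sup>2 - 1)\<close> (\<open>scaled_pow_rem_uniform_limit\<close>).
\<close>

section \<open>Rodrigues formula, derivative relations and three-term recurrence\<close>

lemma pderiv_funpow_diff: "(pderiv ^^ n) (p - q) = (pderiv ^^ n) p - (pderiv ^^ n) (q :: real poly)"
  by (induction n) (simp_all add: pderiv_diff)

lemma pderiv_funpow_smult: "(pderiv ^^ n) (smult c p) = smult c ((pderiv ^^ n) (p :: real poly))"
  by (induction n) (simp_all add: pderiv_smult)

lemma pderiv_X_mult: "pderiv ([:0, 1:] * p) = [:0, 1:] * pderiv p + (p :: 'a :: idom poly)"
  by (simp add: pderiv_mult pderiv_pCons)

lemma two_mult_eq_smult: "2 * p = smult 2 (p :: real poly)"
  by (metis mult_2 one_add_one smult_1_left smult_add_left)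

lemma pderiv_funpow_X_mult:
  "(pderiv ^^ n) ([:0, 1:] * p) =
     [:0, 1:] * (pderiv ^^ n) p + smult (of_nat n) ((pderiv ^^ (n - 1)) (p :: real poly))"
proof (induction n)
  case (Suc n)
  then show ?case
    by (cases n) (simp_all add: pderiv_add pderiv_smult pderiv_X_mult smult_add_left add_ac
      two_mult_eq_smult del: mult_pCons_left)
qed simp

text \<open>
  Both identities come from evaluating the derivative of order \<open>n + 1\<close> of \<open>(x\<^sup>2 - 1) ^ (n + 1)\<close> in two ways:
  once after differentiating the power, once by the Leibniz rule for the factor \<open>x\<^sup>2 - 1\<close>. Together they imply
  every other relation between the Legendre polynomials that is needed below.
\<close>

lemma legendre_Suc:
  "smult (of_nat (Suc n)) (legendre (Suc n)) =
     smult (of_nat (Suc n)) ([:0, 1:] * legendre n) + [:-1, 0, 1:] * pderiv (legendre n)"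
  and pderiv_legendre_Suc:
  "pderiv (legendre (Suc n)) =
     smult (of_nat (Suc n)) (legendre n) + [:0, 1:] * pderiv (legendre n)"
proof -
  define X V :: "real poly" where "X = [:0, 1:]" and "V = [:-1, 0, 1:]"
  define D :: "nat \<Rightarrow> real poly" where "D k = (pderiv ^^ k) (V ^ n)" for k
  define R where "R = (pderiv ^^ Suc n) (V ^ Suc n)"
  define c :: real where "c = 1 / (2 ^ n * fact n)"
  have V: "V = X * X - 1" by (simp add: X_def V_def one_pCons)
  have dV: "pderiv (V ^ Suc n) = smult (2 * of_nat (Suc n)) (X * V ^ n)"
  proof -
    have "pderiv V = smult 2 X" by (simp add: V_def X_def pderiv_pCons)
    then show ?thesis
      unfolding pderiv_power_Suc by (simp add: mult.commute)
  qed
  have DS: "pderiv (D k) = D (Suc k)" for k by (simp add: D_def)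
  have XM: "(pderiv ^^ k) (X * p) = X * (pderiv ^^ k) p + smult (of_nat k) ((pderiv ^^ (k - 1)) p)"
    for k p unfolding X_def by (rule pderiv_funpow_X_mult)
  have "R = (pderiv ^^ n) (pderiv (V ^ Suc n))"
    unfolding R_def by (simp only: funpow_Suc_right o_def)
  also have "\<dots> = smult (2 * of_nat (Suc n)) (X * D n + smult (of_nat n) (D (n - 1)))"
    unfolding dV pderiv_funpow_smult XM D_def by simp
  finally have R1: "R = smult (2 * of_nat (Suc n)) (X * D n + smult (of_nat n) (D (n - 1)))" .
  have "R = (pderiv ^^ Suc n) (X * (X * V ^ n) - V ^ n)"
    unfolding R_def by (subst power_Suc, subst (1) V) (simp only: algebra_simps mult_1_left)
  also have "\<dots> = X * (X * D (Suc n) + smult (of_nat (Suc n)) (D n)) 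
     + smult (of_nat (Suc n)) (X * D n + smult (of_nat n) (D (n - 1))) - D (Suc n)"
    unfolding pderiv_funpow_diff XM D_def by simp
  finally have R2: "R = X * (X * D (Suc n) + smult (of_nat (Suc n)) (D n)) 
     + smult (of_nat (Suc n)) (X * D n + smult (of_nat n) (D (n - 1))) - D (Suc n)" .
  have R3: "smult (1/2) R = smult (of_nat (Suc n)) (X * D n + smult (of_nat n) (D (n - 1)))"
    unfolding R1 smult_smult by (intro arg_cong2[of _ _ _ _ smult] refl) simp
  \<comment> \<open>The term with the derivative of order \<open>n - 1\<close> occurs in both evaluations and cancels.\<close>
  have "smult (1/2) R = R - smult (1/2) R"
    by (rule poly_eqI) simp
  also have "\<dots> = V * D (Suc n) + smult (of_nat (Suc n)) (X * D n)"
    unfolding R3 by (subst R2) (simp add: V algebra_simps)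
  finally have A: "smult (1/2) R = V * D (Suc n) + smult (of_nat (Suc n)) (X * D n)" .
  have L: "legendre n = smult c (D n)" by (simp add: legendre_def c_def D_def V_def)
  have LS: "legendre (Suc n) = smult (c / (2 * of_nat (Suc n))) R"
    unfolding legendre_def R_def c_def V_def by (simp add: field_simps)
  have "smult (of_nat (Suc n)) (legendre (Suc n)) = smult c (smult (1/2) R)"
    unfolding LS by (simp del: of_nat_Suc)
  also have "\<dots> = smult (of_nat (Suc n)) (X * legendre n) + V * pderiv (legendre n)"
    unfolding A L pderiv_smult DS by (simp add: smult_add_right mult.commute del: of_nat_Suc)
  finally show "smult (of_nat (Suc n)) (legendre (Suc n)) =
     smult (of_nat (Suc n)) ([:0, 1:] * legendre n) + [:-1, 0, 1:] * pderiv (legendre n)"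
    by (simp only: X_def V_def)
  have XP: "pderiv (X * p) = X * pderiv p + p" for p
    unfolding X_def by (rule pderiv_X_mult)
  have "pderiv R = smult (2 * of_nat (Suc n)) (X * D (Suc n) + smult (of_nat (Suc n)) (D n))"
  proof (cases n)
    case 0
    then show ?thesis unfolding R1 
      by (simp add: pderiv_smult pderiv_add XP DS)
  next
    case (Suc m)
    have "pderiv (D (n - 1)) = D n" using Suc DS by simp
    then show ?thesis unfolding R1 
      by (simp add: pderiv_smult pderiv_add XP DS smult_add_left add_ac)
  qed
  then show "pderiv (legendre (Suc n)) =
     smult (of_nat (Suc n)) (legendre n) + [:0, 1:] * pderiv (legendre n)"
    unfolding LS L X_def[symmetric] pderiv_smult DS 
    by (simp add: smult_add_right mult.commute del: of_nat_Suc)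
qed

lemma legendre_0 [simp]: "legendre 0 = 1"
  by (simp add: legendre_def)

lemma map_poly_of_real_hom:
  fixes p q :: "real poly"
  shows "map_poly complex_of_real (p + q) = map_poly of_real p + map_poly of_real q"
    and "map_poly complex_of_real (p * q) = map_poly of_real p * map_poly of_real q"
    and "map_poly complex_of_real (smult c p) = smult (of_real c) (map_poly of_real p)"
    and "map_poly complex_of_real (pderiv p) = pderiv (map_poly of_real p)"
  by (auto intro!: poly_eqI simp: coeff_map_poly coeff_mult coeff_pderiv)

lemma poly_map_of_real: "poly (map_poly complex_of_real p) (of_real x) = of_real (poly p x)"
  by (induction p) (auto simp: map_poly_pCons)

text \<open>
  The Legendre polynomials over the complex numbers, where they split into linear factors and can be evaluated
  off the real axis.
\<close>

definition leg :: "nat \<Rightarrow> complex poly" where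
  "leg n = map_poly of_real (legendre n)"

lemma leg_0 [simp]: "leg 0 = 1"
  by (simp add: leg_def map_poly_1)

lemma poly_leg_of_real: "poly (leg n) (of_real x) = of_real (poly (legendre n) x)"
  and poly_pderiv_leg_of_real: "poly (pderiv (leg n)) (of_real x)
    = of_real (poly (pderiv (legendre n)) x)"
  by (simp_all add: leg_def poly_map_of_real flip: map_poly_of_real_hom)

lemma leg_Suc:
  "of_nat (Suc n) * poly (leg (Suc n)) z =
     of_nat (Suc n) * z * poly (leg n) z + (z\<^sup>2 - 1) * poly (pderiv (leg n)) z"
proof -
  have "poly (map_poly of_real (smult (of_nat (Suc n)) (legendre (Suc n)))) z = 
     poly (map_poly complex_of_real (smult (of_nat (Suc n)) ([:0, 1:] * legendre n)
       + [:-1, 0, 1:] * pderiv (legendre n))) z"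
    by (simp only: legendre_Suc)
  then show ?thesis
    by (simp only: map_poly_of_real_hom leg_def[symmetric])
       (simp add: map_poly_pCons power2_eq_square algebra_simps)
qed

lemma pderiv_leg_Suc:
  "poly (pderiv (leg (Suc n))) z = of_nat (Suc n) * poly (leg n) z + z * poly (pderiv (leg n)) z"
proof -
  have "poly (map_poly of_real (pderiv (legendre (Suc n)))) z = 
     poly (map_poly complex_of_real (smult (of_nat (Suc n)) (legendre n)
       + [:0, 1:] * pderiv (legendre n))) z"
    by (simp only: pderiv_legendre_Suc)
  then show ?thesis
    by (simp only: map_poly_of_real_hom leg_def[symmetric])
       (simp add: map_poly_pCons algebra_simps)
qed

lemma leg_1: "poly (leg (Suc 0)) z = z"
  using leg_Suc[of 0 z] by simp

lemma leg_pderiv: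
  "(z\<^sup>2 - 1) * poly (pderiv (leg (Suc n))) z
    = of_nat (Suc n) * (z * poly (leg (Suc n)) z - poly (leg n) z)"
proof -
  have "(z\<^sup>2 - 1) * poly (pderiv (leg (Suc n))) z 
    = of_nat (Suc n) * (z\<^sup>2 - 1) * poly (leg n) z + z * ((z\<^sup>2 - 1) * poly (pderiv (leg n)) z)"
    by (simp add: pderiv_leg_Suc algebra_simps)
  also have "(z\<^sup>2 - 1) * poly (pderiv (leg n)) z
    = of_nat (Suc n) * (poly (leg (Suc n)) z - z * poly (leg n) z)"
    using leg_Suc[of n z] by (simp add: algebra_simps)
  finally show ?thesis by (simp add: algebra_simps power2_eq_square)
qed

text \<open>
  Bonnet's recurrence. From here on the sequences built from Legendre polynomials are compared through it.
\<close>

lemma leg_rec: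
  "of_nat (n + 2) * poly (leg (Suc (Suc n))) z =
     of_nat (2 * n + 3) * z * poly (leg (Suc n)) z - of_nat (n + 1) * poly (leg n) z"
  using leg_Suc[of "Suc n" z] unfolding leg_pderiv by (simp add: algebra_simps)

lemma leg_pderiv_pred:
  "z * poly (pderiv (leg (Suc n))) z - poly (pderiv (leg n)) z = of_nat (Suc n) * poly (leg (Suc n)) z"
  unfolding leg_Suc pderiv_leg_Suc by (simp add: algebra_simps power2_eq_square)

section \<open>Zeros of the Legendre polynomials\<close>

text \<open>
  In the recurrence, \<open>P\<^sub>n\<^sub>+\<^sub>2 * cnj P\<^sub>n\<^sub>+\<^sub>1\<close> is a positive combination of \<open>z * \<bar>P\<^sub>n\<^sub>+\<^sub>1\<bar>\<^sup>2\<close> and \<open>- P\<^sub>n * cnj P\<^sub>n\<^sub>+\<^sub>1\<close>,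
  and both have positive imaginary part. So the quotient \<open>P\<^sub>n\<^sub>+\<^sub>1 / P\<^sub>n\<close> maps the upper half-plane into itself,
  which keeps all zeros on the real axis.
\<close>

lemma Im_leg_ratio_pos:
  assumes "Im z > 0"
  shows "poly (leg n) z \<noteq> 0 \<and> Im (poly (leg (Suc n)) z * cnj (poly (leg n) z)) > 0"
proof (induction n)
  case 0
  then show ?case using assms by (simp add: leg_1)
next
  case (Suc n)
  define a b c where "a = poly (leg n) z" and "b = poly (leg (Suc n)) z"
    and "c = poly (leg (Suc (Suc n))) z"
  have b: "b \<noteq> 0" and im: "Im (b * cnj a) > 0" using Suc by (auto simp: a_def b_def)
  have "of_nat (n + 2) * (c * cnj b) = (of_nat (n + 2) * c) * cnj b" by simp
  also have "\<dots> = of_nat (2 * n + 3) * (z * (b * cnj b)) - of_nat (n + 1) * (a * cnj b)"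
    unfolding a_def b_def c_def leg_rec by (simp add: algebra_simps)
  finally have "Im (of_nat (n + 2) * (c * cnj b)) = 
      Im (of_nat (2 * n + 3) * (z * (b * cnj b)) - of_nat (n + 1) * (a * cnj b))" by simp
  also have "\<dots> = of_nat (2 * n + 3) * (Im z * (cmod b)\<^sup>2) + of_nat (n + 1) * Im (b * cnj a)"
    by (simp add: complex_mult_cnj cmod_power2 del: of_nat_add of_nat_mult) (simp add: algebra_simps)
  also have "\<dots> > 0" using assms b im by (intro add_pos_pos mult_pos_pos) auto
  finally have "real (n + 2) * Im (c * cnj b) > 0" by (simp del: of_nat_add)
  then have "Im (c * cnj b) > 0" by (simp only: zero_less_mult_iff) auto
  then show ?case using b by (simp add: b_def c_def)
qed

lemma leg_nonzero_upper: "Im z > 0 \<Longrightarrow> poly (leg n) z \<noteq> 0"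
  using Im_leg_ratio_pos by blast

lemma poly_leg_cnj: "poly (leg n) (cnj z) = cnj (poly (leg n) z)"
proof -
  have "map_poly cnj (leg n) = leg n"
    by (auto intro!: poly_eqI simp: leg_def coeff_map_poly)
  then show ?thesis by (metis complex_cnj_cnj poly_map_poly_cnj)
qed

lemma leg_root_real: "poly (leg n) z = 0 \<Longrightarrow> Im z = 0"
  using leg_nonzero_upper[of z n] leg_nonzero_upper[of "cnj z" n] poly_leg_cnj[of n z]
  by (cases "Im z" "0 :: real" rule: linorder_cases) auto

lemma leg_no_common_root: "\<not> (poly (leg n) z = 0 \<and> poly (leg (Suc n)) z = 0)"
proof (induction n)
  case (Suc n)
  then show ?case using leg_rec[of n z] by (auto simp del: of_nat_Suc)
qed simp

text \<open>
  At a double zero of \<open>P\<^sub>n\<close>, the derivative relation makes \<open>P\<^sub>n\<^sub>-\<^sub>1\<close> vanish as well; running the recurrence downwards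
  would then give \<open>P\<^sub>0 = 0\<close>.
\<close>

lemma leg_simple_root: "\<not> (poly (leg n) z = 0 \<and> poly (pderiv (leg n)) z = 0)"
proof (cases n)
  case (Suc m)
  then show ?thesis using leg_no_common_root[of m z] leg_pderiv[of z m] by (auto simp del: of_nat_Suc)
qed simp

lemma degree_legendre [simp]: "degree (legendre n) = n"
proof -
  have "degree ((pderiv ^^ k) p) = degree p - k" for k and p :: "real poly"
    by (induction k) (simp_all add: degree_pderiv)
  then show ?thesis by (simp add: legendre_def degree_power_eq)
qed

lemma degree_leg [simp]: "degree (leg n) = n"
  by (simp add: leg_def degree_map_poly)

lemma leg_not_0 [simp]: "leg n \<noteq> 0"
  using leg_nonzero_upper[of \<i> n] by auto

lemma leg_factorization:
  "leg n = smult (lead_coeff (leg n)) (\<Prod>r | poly (leg n) r = 0. [:- r, 1:])"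
  using complex_poly_decompose_rsquarefree[of "leg n"] leg_simple_root by (simp add: rsquarefree_roots)

section \<open>The quadrature of a Cauchy kernel as a rational function\<close>

text \<open>
  The associated polynomials (polynomials of the second kind): up to the normalisation \<open>W\<^sub>1 = 2\<close>, the length
  of the interval, they are the numerators of the continued fraction whose denominators are the Legendre polynomials.
\<close>

fun assoc_leg :: "nat \<Rightarrow> complex poly" where
  "assoc_leg 0 = 0"
| "assoc_leg (Suc 0) = [:2:]"
| "assoc_leg (Suc (Suc n)) = smult (1 / of_nat (n + 2))
     (smult (of_nat (2 * n + 3)) ([:0, 1:] * assoc_leg (Suc n)) - smult (of_nat (n + 1)) (assoc_leg n))"

lemma assoc_leg_rec:
  "of_nat (n + 2) * poly (assoc_leg (Suc (Suc n))) z =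
     of_nat (2 * n + 3) * z * poly (assoc_leg (Suc n)) z - of_nat (n + 1) * poly (assoc_leg n) z"
proof -
  have "of_nat (n + 2) \<noteq> (0 :: complex)" by (simp only: of_nat_eq_0_iff)
  then show ?thesis by (simp only: assoc_leg.simps) (simp add: field_simps del: of_nat_add)
qed

declare assoc_leg.simps(3) [simp del]

lemma degree_assoc_leg: "degree (assoc_leg n) \<le> n - 1"
proof (induction n rule: assoc_leg.induct)
  case (3 n)
  have "degree ([:0, 1:] * assoc_leg (Suc n)) \<le> Suc n"
    using degree_mult_le[of "[:0, 1:]" "assoc_leg (Suc n)"] 3(1) by simp
  then have "degree (smult (of_nat (2 * n + 3)) ([:0, 1:] * assoc_leg (Suc n))) \<le> Suc n"
    using degree_smult_le order_trans by blast
  moreover have "degree (smult (of_nat (n + 1)) (assoc_leg n)) \<le> Suc n"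
    using degree_smult_le 3(2) by (meson diff_le_self le_SucI le_trans)
  ultimately have "degree (smult (of_nat (2 * n + 3)) ([:0, 1:] * assoc_leg (Suc n))
    - smult (of_nat (n + 1)) (assoc_leg n)) \<le> Suc n"
    by (rule degree_diff_le)
  then show ?case unfolding assoc_leg.simps(3) using degree_smult_le order_trans by fastforce
qed auto

text \<open>
  Two solutions of the same three-term recurrence: multiplying the Casoratian by \<open>n + 1\<close> makes it independent of \<open>n\<close>.
\<close>

lemma casoratian:
  "poly (leg (Suc n)) z * poly (assoc_leg n) z - poly (leg n) z * poly (assoc_leg (Suc n)) z
    = - 2 / of_nat (Suc n)"
proof (induction n)
  case (Suc n)
  have nz: "of_nat (n + 2) \<noteq> (0 :: complex)" "of_nat (n + 1) \<noteq> (0 :: complex)" 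
    by (simp_all only: of_nat_eq_0_iff)
  have "of_nat (n + 2) * (poly (leg (Suc (Suc n))) z * poly (assoc_leg (Suc n)) z
    - poly (leg (Suc n)) z * poly (assoc_leg (Suc (Suc n))) z)
     = (of_nat (n + 2) * poly (leg (Suc (Suc n))) z) * poly (assoc_leg (Suc n)) z 
       - poly (leg (Suc n)) z * (of_nat (n + 2) * poly (assoc_leg (Suc (Suc n))) z)"
    by (simp only: algebra_simps)
  also have "\<dots> = of_nat (n + 1)
    * (poly (leg (Suc n)) z * poly (assoc_leg n) z - poly (leg n) z * poly (assoc_leg (Suc n)) z)"
    unfolding leg_rec assoc_leg_rec by (simp only: algebra_simps)
  also have "\<dots> = - 2" unfolding Suc using nz(2) by (simp del: of_nat_add of_nat_Suc)
  finally show ?case using nz(1) by (simp add: field_simps del: of_nat_add of_nat_Suc)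
qed simp

text \<open>
  Lagrange interpolation of \<open>q\<close> at the zeros of \<open>p\<close>, divided by \<open>p\<close>.
\<close>

lemma partial_fractions_simple_roots:
  fixes p q :: "complex poly" and c :: complex
  assumes fin: "finite A" and p: "p = smult c (\<Prod>r\<in>A. [:- r, 1:])" and c: "c \<noteq> 0"
    and deg: "degree q < card A" and z: "z \<notin> A"
  shows "poly q z / poly p z = (\<Sum>r\<in>A. poly q r / poly (pderiv p) r / (z - r))"
proof -
  \<comment> \<open>The quotient of \<open>p\<close> by its linear factor at \<open>r\<close>, so that \<open>l r\<close> takes the value \<open>p'(r)\<close> at \<open>r\<close>.\<close>
  define l where "l r = smult c (\<Prod>s\<in>A - {r}. [:- s, 1:])" for r
  have pl: "p = [:- r, 1:] * l r" if "r \<in> A" for r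
    unfolding p l_def using that fin by (subst prod.remove[of A r]) (auto simp del: mult_pCons_left)
  have dp: "poly (pderiv p) r = poly (l r) r" if "r \<in> A" for r
    by (subst pl[OF that], subst pderiv_mult) (simp add: pderiv_pCons)
  have l_other: "poly (l r) s = 0" if "s \<in> A" "s \<noteq> r" for r s
    using that fin by (auto simp: l_def poly_prod)
  have l_self: "poly (l r) r \<noteq> 0" if "r \<in> A" for r
    using that fin c by (auto simp: l_def poly_prod)
  define h where "h = q - (\<Sum>r\<in>A. smult (poly q r / poly (pderiv p) r) (l r))"
  have root: "poly h s = 0" if "s \<in> A" for s
  proof -
    have "(\<Sum>r\<in>A. poly q r / poly (pderiv p) r * poly (l r) s)
       = (\<Sum>r\<in>A. if r = s then poly q s else 0)"
      using that by (intro sum.cong) (auto simp: l_other dp l_self)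
    then show ?thesis using that fin by (simp add: h_def poly_sum)
  qed
  have degl: "degree (l r) < card A" if "r \<in> A" for r
  proof -
    have "degree (l r) = card (A - {r})"
      using c unfolding l_def by (simp add: degree_prod_sum_eq)
    then show ?thesis using that fin by (auto simp: card_gt_0_iff intro: diff_less)
  qed
  have "h = 0"
  proof (rule ccontr)
    assume "h \<noteq> 0"
    have "degree h < card A"
      unfolding h_def using deg degl
      by (intro degree_diff_less degree_sum_less) (auto intro: le_less_trans[OF degree_smult_le])
    moreover have "card A \<le> card {x. poly h x = 0}"
      using root poly_roots_finite[OF \<open>h \<noteq> 0\<close>] by (intro card_mono) auto
    ultimately show False using card_poly_roots_bound[OF \<open>h \<noteq> 0\<close>] by simp
  qed
  then have "q = (\<Sum>r\<in>A. smult (poly q r / poly (pderiv p) r) (l r))" by (simp add: h_def)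
  then have "poly q z = (\<Sum>r\<in>A. poly q r / poly (pderiv p) r * poly (l r) z)"
    by (metis (no_types, lifting) poly_smult poly_sum sum.cong)
  then have "poly q z / poly p z = 
      (\<Sum>r\<in>A. poly q r / poly (pderiv p) r * (poly (l r) z / poly p z))"
    by (simp add: sum_divide_distrib)
  also have "\<dots> = (\<Sum>r\<in>A. poly q r / poly (pderiv p) r / (z - r))"
  proof (intro sum.cong refl)
    fix r assume r: "r \<in> A"
    have "poly (l r) z \<noteq> 0" using z fin c by (auto simp: l_def poly_prod)
    moreover have "z \<noteq> r" using z r by auto
    ultimately have "poly (l r) z / poly p z = 1 / (z - r)"
      by (subst pl[OF r]) (simp add: field_simps)
    then show "poly q r / poly (pderiv p) r * (poly (l r) z / poly p z) =
      poly q r / poly (pderiv p) r / (z - r)" by (simp only: times_divide_eq_right mult_1_right)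
  qed
  finally show ?thesis .
qed

text \<open>
  The weights are the residues of \<open>W\<^sub>n / P\<^sub>n\<close>. Indeed at a zero \<open>x\<close> the derivative relation reads
  \<open>(1 - x\<^sup>2) P\<^sub>n'(x) = n P\<^sub>n\<^sub>-\<^sub>1(x)\<close> and the Casoratian reads \<open>P\<^sub>n\<^sub>-\<^sub>1(x) W\<^sub>n(x) = 2 / n\<close>, hence
  \<open>W\<^sub>n(x) / P\<^sub>n'(x) = 2 / ((1 - x\<^sup>2) P\<^sub>n'(x)\<^sup>2)\<close>.
\<close>

lemma gl_rule_stieltjes:
  assumes "Im z > 0"
  shows "gl_rule n (\<lambda>x. 1 / (z - of_real x)) = poly (assoc_leg n) z / poly (leg n) z"
proof (cases n)
  case 0
  then show ?thesis by (simp add: gl_rule_def)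
next
  case (Suc m)
  define A where "A = {r. poly (leg n) r = 0}"
  have fin: "finite A" unfolding A_def by (rule poly_roots_finite) simp
  have A_real: "A = of_real ` {x. poly (legendre n) x = 0}"
  proof (intro set_eqI iffI)
    fix r assume "r \<in> A"
    then have "Im r = 0" "poly (leg n) r = 0" using leg_root_real by (auto simp: A_def)
    then have "r = of_real (Re r)" by (simp add: complex_eq_iff)
    moreover from this have "poly (legendre n) (Re r) = 0" 
      using \<open>poly (leg n) r = 0\<close> poly_leg_of_real[of n "Re r"] by simp
    ultimately show "r \<in> of_real ` {x. poly (legendre n) x = 0}" by blast
  qed (auto simp: A_def poly_leg_of_real)
  have card: "card A = n"
  proof -
    have "n = degree (smult (lead_coeff (leg n)) (\<Prod>r\<in>A. [:- r, 1:]))"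
      unfolding A_def by (subst leg_factorization[symmetric]) simp
    also have "\<dots> = card A" using leading_coeff_0_iff[of "leg n"] by (simp add: degree_prod_sum_eq)
    finally show ?thesis ..
  qed
  have "poly (assoc_leg n) z / poly (leg n) z = 
      (\<Sum>r\<in>A. poly (assoc_leg n) r / poly (pderiv (leg n)) r / (z - r))"
  proof (rule partial_fractions_simple_roots[OF fin])
    show "leg n = smult (lead_coeff (leg n)) (\<Prod>r\<in>A. [:- r, 1:])"
      unfolding A_def by (rule leg_factorization)
    show "degree (assoc_leg n) < card A" using degree_assoc_leg[of n] card Suc by simp
    show "z \<notin> A" using leg_nonzero_upper[OF assms] by (simp add: A_def)
  qed (use leading_coeff_0_iff[of "leg n"] in simp)
  also have "\<dots> = (\<Sum>x | poly (legendre n) x = 0. 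
      poly (assoc_leg n) (of_real x) / poly (pderiv (leg n)) (of_real x) / (z - of_real x))"
    unfolding A_real by (subst sum.reindex) (auto simp: inj_on_def)
  also have "\<dots> = gl_rule n (\<lambda>x. 1 / (z - of_real x))"
    unfolding gl_rule_def
  proof (intro sum.cong refl)
    fix x assume "x \<in> {x. poly (legendre n) x = 0}"
    then have P: "poly (leg n) (of_real x) = 0" by (simp add: poly_leg_of_real)
    define d where "d = poly (pderiv (leg n)) (of_real x)"
    have d: "d \<noteq> 0" using P leg_simple_root[of n "of_real x"] by (auto simp: d_def)
    have e1: "(1 - (of_real x)\<^sup>2) * d = of_nat n * poly (leg m) (of_real x)"
      using leg_pderiv[of "of_real x" m] P Suc by (simp add: d_def algebra_simps)
    have e2: "poly (leg m) (of_real x) * poly (assoc_leg n) (of_real x) = 2 / of_nat n"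
      using casoratian[of m "of_real x"] P Suc by simp
    have nz: "of_nat n \<noteq> (0 :: complex)" using Suc by (simp del: of_nat_Suc)
    have e3: "of_nat n * poly (leg m) (of_real x) \<noteq> 0" 
      using e2 nz by auto
    have "poly (assoc_leg n) (of_real x) = 2 / ((1 - (of_real x)\<^sup>2) * d)"
      using e2 e3 nz unfolding e1 by (simp add: field_simps)
    then have "poly (assoc_leg n) (of_real x) / d = of_real (gl_weight n x)"
      by (simp add: gl_weight_def d_def poly_pderiv_leg_of_real power2_eq_square)
    then show "poly (assoc_leg n) (of_real x) / poly (pderiv (leg n)) (of_real x) / (z - of_real x) = 
       1 / (z - of_real x) * of_real (gl_weight n x)"
      by (simp add: d_def)
  qed
  finally show ?thesis ..
qed

section \<open>The remainder of a Cauchy kernel\<close>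

text \<open>
  An antiderivative of \<open>(n + 2) P\<^sub>n\<^sub>+\<^sub>1\<close> is \<open>x P\<^sub>n\<^sub>+\<^sub>1 - P\<^sub>n\<close>, a multiple of \<open>(x\<^sup>2 - 1) P\<^sub>n\<^sub>+\<^sub>1'\<close>, which vanishes
  at both end points.
\<close>

lemma integral_leg_Suc: "integral {-1..1} (\<lambda>x. poly (leg (Suc n)) (of_real x)) = 0"
proof -
  define G where "G z = z * poly (leg (Suc n)) z - poly (leg n) z" for z
  have G0: "G 1 = 0" "G (- 1) = 0"
    using leg_pderiv[of 1 n] leg_pderiv[of "-1" n] by (auto simp: G_def simp del: of_nat_Suc)
  have "(G has_field_derivative of_nat (n + 2) * poly (leg (Suc n)) z) (at z)" for z
  proof -
    have "(G has_field_derivative poly (leg (Suc n)) z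
      + (z * poly (pderiv (leg (Suc n))) z - poly (pderiv (leg n)) z)) (at z)"
      unfolding G_def by (auto intro!: derivative_eq_intros)
    then show ?thesis unfolding leg_pderiv_pred by (simp add: algebra_simps)
  qed
  then have "((\<lambda>x. of_nat (n + 2) * poly (leg (Suc n)) (of_real x)) has_integral (G (of_real 1)
    - G (of_real (- 1)))) {-1..1}"
    by (intro fundamental_theorem_of_calculus has_vector_derivative_real_field) auto
  then have "((\<lambda>x. of_nat (n + 2) * poly (leg (Suc n)) (of_real x)) has_integral 0) {-1..1}"
    by (simp add: G0)
  from has_integral_mult_right[OF this, of "1 / of_nat (n + 2)"]
  have "((\<lambda>x. poly (leg (Suc n)) (of_real x)) has_integral 0) {-1..1}"
    by (simp add: field_simps del: of_nat_Suc of_nat_add)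
  then show ?thesis by (rule integral_unique)
qed

lemma upper_neq_real: "Im z > 0 \<Longrightarrow> z - of_real x \<noteq> 0"
  by (auto simp: complex_eq_iff)

lemma leg_integrable:
  assumes "Im z > 0"
  shows "(\<lambda>x. poly (leg n) (of_real x) / (z - of_real x)) integrable_on {-1..1}"
    and "(\<lambda>x. poly (leg n) (of_real x)) integrable_on {-1..1}"
  using upper_neq_real[OF assms] by (auto intro!: integrable_continuous_real continuous_intros)

text \<open>
  The left side is twice the Legendre function of the second kind. It satisfies the recurrence because
  \<open>x / (z - x) = z / (z - x) - 1\<close> and the additional integral of \<open>P\<^sub>n\<^sub>+\<^sub>1\<close> is zero, so the two sides agree
  as soon as they agree for \<open>n = 0\<close> and \<open>n = 1\<close>.
\<close>

lemma legendre_second_kind: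
  assumes z: "Im z > 0"
  shows "integral {-1..1} (\<lambda>x. poly (leg n) (of_real x) / (z - of_real x)) =
    poly (leg n) z * integral {-1..1} (\<lambda>x. 1 / (z - of_real x)) - poly (assoc_leg n) z"
proof (induction n rule: assoc_leg.induct)
  case 1
  then show ?case by simp
next
  case 2
  have "integral {-1..1} (\<lambda>x. poly (leg (Suc 0)) (of_real x) / (z - of_real x))
     = integral {-1..1} (\<lambda>x. z * (1 / (z - of_real x)) - 1)"
    by (intro integral_cong) (use upper_neq_real[OF z] in \<open>simp add: leg_1 field_simps\<close>)
  also have "\<dots> = z * integral {-1..1} (\<lambda>x. 1 / (z - of_real x)) - 2"
    using integrable_on_mult_right[OF leg_integrable(1)[OF z, of 0], of z]
      integral_mult_right[of "{-1..1}" z "\<lambda>x. 1 / (z - complex_of_real x)"]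
    by (subst integral_diff) (auto simp: scaleR_conv_of_real intro: integrable_const_ivl)
  finally show ?case by (simp add: leg_1)
next
  case (3 n)
  define J where "J m = integral {-1..1} (\<lambda>x. poly (leg m) (of_real x) / (z - of_real x))" for m
  define L where "L = integral {-1..1} (\<lambda>x. 1 / (z - complex_of_real x))"
  have int: "(\<lambda>x. c * (poly (leg m) (of_real x) / (z - of_real x))) integrable_on {-1..1}"
     "(\<lambda>x. c * poly (leg m) (of_real x)) integrable_on {-1..1}" for c m
    by (intro integrable_on_mult_right leg_integrable[OF z])+
  have "of_nat (n + 2) * J (Suc (Suc n))
    = integral {-1..1} (\<lambda>x. of_nat (n + 2) * (poly (leg (Suc (Suc n))) (of_real x) / (z - of_real x)))"
    unfolding J_def by (rule integral_mult_right[symmetric])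
  also have "\<dots> = integral {-1..1}
    (\<lambda>x. (of_nat (2 * n + 3) * z) * (poly (leg (Suc n)) (of_real x) / (z - of_real x))
      - of_nat (2 * n + 3) * poly (leg (Suc n)) (of_real x)
        - of_nat (n + 1) * (poly (leg n) (of_real x) / (z - of_real x)))"
  proof (rule integral_cong)
    fix x :: real
    show "of_nat (n + 2) * (poly (leg (Suc (Suc n))) (of_real x) / (z - of_real x)) = 
      (of_nat (2 * n + 3) * z) * (poly (leg (Suc n)) (of_real x) / (z - of_real x))
      - of_nat (2 * n + 3) * poly (leg (Suc n)) (of_real x)
        - of_nat (n + 1) * (poly (leg n) (of_real x) / (z - of_real x))"
      unfolding times_divide_eq_right leg_rec using upper_neq_real[OF z, of x] 
      by (simp add: divide_simps del: of_nat_add of_nat_mult)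
        (simp add: algebra_simps del: of_nat_add of_nat_mult)
  qed
  also have "\<dots> = (of_nat (2 * n + 3) * z) * J (Suc n) - of_nat (n + 1) * J n"
    by (subst integral_diff, intro integrable_diff int, rule int, subst integral_diff, rule int, rule
      int,
        unfold integral_mult_right integral_leg_Suc J_def) (simp only: mult_zero_right diff_zero)
  also have "\<dots> = (of_nat (2 * n + 3) * z) * (poly (leg (Suc n)) z * L - poly (assoc_leg (Suc n)) z) 
       - of_nat (n + 1) * (poly (leg n) z * L - poly (assoc_leg n) z)"
    unfolding J_def L_def by (simp only: 3)
  also have "\<dots> = (of_nat (2 * n + 3) * z * poly (leg (Suc n)) z - of_nat (n + 1) * poly (leg n) z) * L 
       - (of_nat (2 * n + 3) * z * poly (assoc_leg (Suc n)) z - of_nat (n + 1) * poly (assoc_leg n) z)"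
    by (simp only: algebra_simps)
  also have "\<dots> = of_nat (n + 2) * (poly (leg (Suc (Suc n))) z * L - poly (assoc_leg (Suc (Suc n))) z)"
    unfolding leg_rec[symmetric] assoc_leg_rec[symmetric] by (simp only: algebra_simps)
  finally have "of_nat (n + 2) * J (Suc (Suc n))
    = of_nat (n + 2) * (poly (leg (Suc (Suc n))) z * L - poly (assoc_leg (Suc (Suc n))) z)" .
  moreover have "of_nat (n + 2) \<noteq> (0 :: complex)" by (simp only: of_nat_eq_0_iff)
  ultimately show ?case unfolding J_def L_def by (simp only: mult_cancel_left) simp
qed

definition cauchy_rem :: "nat \<Rightarrow> complex \<Rightarrow> complex" where
  "cauchy_rem n z = gl_remainder n (\<lambda>x. 1 / (z - of_real x))"

text \<open>
  This form of the remainder is used only to see that it tends to zero: the numerator stays bounded while \<open>P\<^sub>n(z)\<close>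
  grows.
\<close>

lemma cauchy_rem_eq_second_kind:
  assumes "Im z > 0"
  shows "cauchy_rem n z = integral {-1..1}
    (\<lambda>x. poly (leg n) (of_real x) / (z - of_real x)) / poly (leg n) z"
  unfolding legendre_second_kind[OF assms] cauchy_rem_def gl_remainder_def gl_rule_stieltjes[OF assms]
  using leg_nonzero_upper[OF assms, of n] by (simp add: field_simps)

text \<open>
  The integral of the kernel cancels, and the difference of the two quotients \<open>W\<^sub>n / P\<^sub>n\<close> is the Casoratian over
  the product of the denominators.
\<close>

lemma cauchy_rem_step:
  assumes "Im z > 0"
  shows "cauchy_rem n z - cauchy_rem (Suc n) z
    = 2 / (of_nat (Suc n) * poly (leg n) z * poly (leg (Suc n)) z)"
proof -
  define A B a b where "A = poly (leg n) z" and "B = poly (leg (Suc n)) z"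
    and "a = poly (assoc_leg n) z" and "b = poly (assoc_leg (Suc n)) z"
  have nz: "A \<noteq> 0" "B \<noteq> 0" using leg_nonzero_upper[OF assms] by (auto simp: A_def B_def)
  have "cauchy_rem n z - cauchy_rem (Suc n) z = b / B - a / A"
    by (simp add: cauchy_rem_def gl_remainder_def gl_rule_stieltjes[OF assms] A_def B_def a_def b_def)
  also have "\<dots> = - (B * a - A * b) / (A * B)" using nz by (simp add: field_simps)
  also have "B * a - A * b = - 2 / of_nat (Suc n)"
    using casoratian[of n z] by (simp add: A_def B_def a_def b_def)
  finally show ?thesis by (simp add: A_def B_def mult.assoc del: of_nat_Suc)
qed

section \<open>The expansion of the Legendre polynomials in powers of the Joukowski variable\<close>

text \<open>
  This is \<open>binomial (2 k) k / 4 ^ k\<close>, the coefficient of \<open>t ^ k\<close> in \<open>(1 - t) powr (-1/2)\<close>.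
\<close>

primrec cbin :: "nat \<Rightarrow> real" where
  "cbin 0 = 1"
| "cbin (Suc k) = cbin k * (2 * real k + 1) / (2 * real k + 2)"

lemma cbin_pos: "cbin k > 0"
  by (induction k) (auto intro!: divide_pos_pos mult_pos_pos)

lemma cbin_le_1: "cbin k \<le> 1"
proof (induction k)
  case (Suc k)
  have "cbin (Suc k) = cbin k * ((2 * real k + 1) / (2 * real k + 2))" by simp
  also have "\<dots> \<le> 1 * 1" using Suc cbin_pos[of k] by (intro mult_mono) auto
  finally show ?case by simp
qed simp

text \<open>
  The factors \<open>(2 k + 1) / (2 k + 2)\<close> increase with \<open>k\<close>, so the \<open>k\<close> factors that lead from \<open>l\<close> to \<open>k + l\<close> are at
  least as large as the first \<open>k\<close>. This inequality supplies the dominating series for the expansion below.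
\<close>

lemma cbin_mult_le: "cbin k * cbin l \<le> cbin (k + l)"
proof (induction k)
  case (Suc k)
  have "cbin (Suc k) * cbin l = (cbin k * cbin l) * ((2 * real k + 1) / (2 * real k + 2))" by simp
  also have "\<dots> \<le> cbin (k + l) * ((2 * real (k + l) + 1) / (2 * real (k + l) + 2))"
    using Suc cbin_pos[of "k + l"] by (intro mult_mono) (auto simp: divide_simps algebra_simps)
  also have "\<dots> = cbin (Suc k + l)" by simp
  finally show ?case .
qed simp

lemma cbin_ratio: "(\<lambda>n. cbin n / cbin (n + k)) \<longlonglongrightarrow> 1"
proof (induction k)
  case 0
  then show ?case using cbin_pos less_imp_neq[OF cbin_pos]
    by (simp add: less_imp_neq[OF cbin_pos, symmetric])
next
  case (Suc k)
  have "(\<lambda>n. (2 * real (n + k) + 2) / (2 * real (n + k) + 1)) \<longlonglongrightarrow> 1"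
    by real_asymp
  from tendsto_mult[OF Suc this] show ?case
    by (simp add: field_simps)
qed

text \<open>
  The partial products of Wallis' product equal \<open>1 / ((2 n + 1) g\<^sub>n\<^sup>2)\<close>, and \<open>(n + 1) g\<^sub>n\<^sub>+\<^sub>1 = (2 n + 1) g\<^sub>n / 2\<close>.
\<close>

lemma cbin_wallis: "(\<lambda>n. real (Suc n) * cbin n * cbin (Suc n)) \<longlonglongrightarrow> 1 / pi"
proof -
  have *: "(\<Prod>k=1..n. (4*real k^2) / (4*real k^2 - 1)) = 1 / ((2 * real n + 1) * (cbin n)\<^sup>2)" for n
  proof (induction n)
    case (Suc n)
    have e: "4 * real (Suc n) ^ 2 - 1 = (2 * real n + 1) * (2 * real n + 3)"
      by (simp add: power2_eq_square algebra_simps)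
    have nz: "2 * real n + 1 \<noteq> 0" "2 * real n + 3 \<noteq> 0" "real n + 1 \<noteq> 0" "cbin n \<noteq> 0"
      using cbin_pos[of n] by (auto simp del: of_nat_Suc)
    show ?case unfolding prod.cl_ivl_Suc Suc e using nz
      by (simp add: divide_simps power2_eq_square) (simp add: algebra_simps)
  qed simp
  have "(\<lambda>n. inverse (\<Prod>k=1..n. (4*real k^2) / (4*real k^2 - 1)) / 2) \<longlonglongrightarrow> inverse (pi / 2) / 2"
    by (intro tendsto_intros wallis) auto
  moreover have "inverse (\<Prod>k=1..n. (4*real k^2) / (4*real k^2 - 1)) / 2
    = real (Suc n) * cbin n * cbin (Suc n)" for n
    unfolding * by (simp add: field_simps power2_eq_square)
  ultimately show ?thesis by (simp add: inverse_eq_divide)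
qed

text \<open>
  The power series of \<open>(1 - u t) powr (-1/2)\<close>; the next lemma is its differential equation.
\<close>

definition cbin_fps :: "complex \<Rightarrow> complex fps" where
  "cbin_fps u = Abs_fps (\<lambda>k. of_real (cbin k) * u ^ k)"

lemma cbin_fps_ode: "(1 - fps_const u * fps_X) * fps_deriv (cbin_fps u)
  = fps_const (u / 2) * cbin_fps u"
proof (rule fps_ext)
  fix k
  have cbS: "of_nat (Suc k) * of_real (cbin (Suc k))
    = of_real (cbin k) * (2 * of_nat k + 1) / (2 :: complex)"
  proof -
    have "real (Suc k) * cbin (Suc k) = cbin k * (2 * real k + 1) / 2" by (simp add: field_simps)
    then have "complex_of_real (real (Suc k) * cbin (Suc k))
      = complex_of_real (cbin k * (2 * real k + 1) / 2)" by (rule arg_cong)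
    then show ?thesis by (simp del: cbin.simps)
  qed
  have "fps_nth ((1 - fps_const u * fps_X) * fps_deriv (cbin_fps u)) k =
     of_nat (Suc k) * of_real (cbin (Suc k)) * u ^ Suc k - u * (of_nat k * of_real (cbin k) * u ^ k)"
    by (cases k) (simp_all add: cbin_fps_def algebra_simps del: cbin.simps of_nat_Suc)
  also have "\<dots> = fps_nth (fps_const (u / 2) * cbin_fps u) k"
    unfolding cbS by (simp add: cbin_fps_def field_simps)
  finally show "fps_nth ((1 - fps_const u * fps_X) * fps_deriv (cbin_fps u)) k
    = fps_nth (fps_const (u / 2) * cbin_fps u) k" .
qed

text \<open>
  The product \<open>G\<close> of the two series satisfies \<open>(1 - (u + v) t + t\<^sup>2) G' = ((u + v) / 2 - t) G\<close>, and comparing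
  coefficients gives Bonnet's recurrence at \<open>z = (u + v) / 2\<close>.
\<close>

lemma cbin_fps_prod_rec:
  assumes "u * v = 1"
  defines "G \<equiv> fps_nth (cbin_fps u * cbin_fps v)"
  shows "of_nat (n + 2) * G (Suc (Suc n))
    = of_nat (2 * n + 3) * ((u + v) / 2) * G (Suc n) - of_nat (n + 1) * G n"
proof -
  define A B X where "A = cbin_fps u" and "B = cbin_fps v" and "X = (fps_X :: complex fps)"
  have uv: "fps_const u * fps_const v = 1" using assms by (simp add: fps_const_mult)
  have "(1 - fps_const (u + v) * X + X * X) * fps_deriv (A * B) = 
      (1 - fps_const u * X) * (1 - fps_const v * X) * fps_deriv (A * B)"
  proof -
    have "(1 - fps_const u * X) * (1 - fps_const v * X)
      = 1 - (fps_const u + fps_const v) * X + (fps_const u * fps_const v) * (X * X)"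
      by (simp only: algebra_simps mult_1_left)
    then show ?thesis unfolding uv by (simp add: fps_const_add)
  qed
  also have "\<dots> = ((1 - fps_const u * X) * fps_deriv A) * (1 - fps_const v * X) * B 
      + ((1 - fps_const v * X) * fps_deriv B) * (1 - fps_const u * X) * A"
    by (simp add: algebra_simps del: fps_const_mult)
  also have "\<dots> = (fps_const (u / 2) * (1 - fps_const v * X) + fps_const (v / 2) * (1 - fps_const u * X))
    * (A * B)"
    unfolding A_def B_def X_def cbin_fps_ode by (simp only: algebra_simps)
  also have "fps_const (u / 2) * (1 - fps_const v * X) + fps_const (v / 2) * (1 - fps_const u * X)
     = fps_const ((u + v) / 2) - X"
  proof -
    have "fps_const (u / 2) * fps_const v = fps_const (1/2)" "fps_const (v / 2) * fps_const u
      = fps_const (1/2)"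
      using assms(1) by (simp_all add: fps_const_mult mult.commute)
    moreover have "fps_const (u / 2) * (1 - fps_const v * X) + fps_const (v / 2) * (1 - fps_const u * X)
      = (fps_const (u / 2) + fps_const (v / 2))
        - (fps_const (u / 2) * fps_const v + fps_const (v / 2) * fps_const u) * X"
      by (simp only: algebra_simps mult_1_left)
    ultimately show ?thesis by (simp add: fps_const_add add_divide_distrib)
  qed
  finally have ode: "(1 - fps_const (u + v) * X + X * X) * fps_deriv (A * B) =
      (fps_const ((u + v) / 2) - X) * (A * B)" .
  define C where "C = A * B"
  have "fps_nth ((1 - fps_const (u + v) * X + X * X) * fps_deriv C) (Suc n) =
      fps_nth ((fps_const ((u + v) / 2) - X) * C) (Suc n)"
    unfolding C_def ode ..
  then have "of_nat (n + 2) * fps_nth C (Suc (Suc n)) - (u + v) * (of_nat (n + 1) * fps_nth C (Suc n))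
      + of_nat n * fps_nth C n = (u + v) / 2 * fps_nth C (Suc n) - fps_nth C n"
    unfolding X_def by (cases n) (simp_all add: ring_distribs mult.assoc)
  then show ?thesis
    unfolding G_def A_def[symmetric] B_def[symmetric] C_def[symmetric] by (simp add: field_simps)
qed

lemma leg_eq_cbin_fps: "u * v = 1 \<Longrightarrow> poly (leg n) ((u + v) / 2) = fps_nth (cbin_fps u * cbin_fps v) n"
proof (induction n rule: assoc_leg.induct)
  case 2
  then show ?case by (simp add: leg_1 fps_mult_nth cbin_fps_def field_simps)
next
  case (3 n)
  have "of_nat (n + 2) * poly (leg (Suc (Suc n))) ((u + v) / 2)
    = of_nat (n + 2) * fps_nth (cbin_fps u * cbin_fps v) (Suc (Suc n))"
    unfolding leg_rec cbin_fps_prod_rec[OF 3(3)] 3(1)[OF 3(3)] 3(2)[OF 3(3)] ..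
  moreover have "of_nat (n + 2) \<noteq> (0 :: complex)" by (simp only: of_nat_eq_0_iff)
  ultimately show ?case by (simp only: mult_cancel_left) simp
qed (simp add: cbin_fps_def)

lemma leg_at_1: "poly (leg n) 1 = 1"
proof (induction n)
  case (Suc n)
  then show ?case using leg_Suc[of n 1] by (simp del: of_nat_Suc)
qed simp

text \<open>
  The expansion at \<open>u = v = 1\<close>, where all Legendre polynomials equal \<open>1\<close>.
\<close>

lemma cbin_convolution: "(\<Sum>k\<le>n. cbin k * cbin (n - k)) = 1"
proof -
  have "complex_of_real (\<Sum>k\<le>n. cbin k * cbin (n - k)) = fps_nth (cbin_fps 1 * cbin_fps 1) n"
    by (simp add: fps_mult_nth cbin_fps_def atMost_atLeast0)
  also have "\<dots> = 1" using leg_eq_cbin_fps[of 1 1 n] by (simp add: leg_at_1)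
  finally show ?thesis by (simp only: of_real_eq_1_iff)
qed

lemma leg_expansion:
  assumes "u \<noteq> 0"
  shows "poly (leg n) ((u + 1 / u) / 2)
    = u ^ n * (\<Sum>k\<le>n. of_real (cbin k * cbin (n - k)) * (1 / u\<^sup>2) ^ k)"
proof -
  have "poly (leg n) ((u + 1 / u) / 2) = fps_nth (cbin_fps (1 / u) * cbin_fps u) n"
    using leg_eq_cbin_fps[of "1 / u" u n] assms by (simp add: add.commute)
  also have "\<dots> = (\<Sum>k\<le>n. of_real (cbin k) * (1 / u) ^ k * (of_real (cbin (n - k)) * u ^ (n - k)))"
    by (simp add: fps_mult_nth cbin_fps_def atMost_atLeast0)
  also have "\<dots> = (\<Sum>k\<le>n. u ^ n * (of_real (cbin k * cbin (n - k)) * (1 / u\<^sup>2) ^ k))"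
  proof (intro sum.cong refl)
    fix k assume "k \<in> {..n}"
    then have "u ^ n = u ^ (n - k) * u ^ k" by (simp flip: power_add)
    then show "of_real (cbin k) * (1 / u) ^ k * (of_real (cbin (n - k)) * u ^ (n - k)) = 
       u ^ n * (of_real (cbin k * cbin (n - k)) * (1 / u\<^sup>2) ^ k)"
      using assms by (simp add: power_divide power2_eq_square power_mult_distrib)
  qed
  finally show ?thesis by (simp add: sum_distrib_left)
qed

text \<open>
  For \<open>x = cos \<theta>\<close> take \<open>u = cis \<theta>\<close> in the expansion: the coefficients are positive and add up to \<open>1\<close>.
\<close>

lemma norm_leg_le_1:
  assumes "x \<in> {-1..1}"
  shows "norm (poly (leg n) (of_real x)) \<le> 1"
proof -
  define u where "u = cis (arccos x)"
  have u: "norm u = 1" "u \<noteq> 0" by (auto simp: u_def)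
  have "(u + 1 / u) / 2 = of_real x"
    using assms by (simp add: u_def complex_eq_iff inverse_eq_divide[symmetric])
  then have "norm (poly (leg n) (of_real x))
    = norm (\<Sum>k\<le>n. of_real (cbin k * cbin (n - k)) * (1 / u\<^sup>2) ^ k)"
    using leg_expansion[OF u(2), of n] u by (simp add: norm_mult norm_power)
  also have "\<dots> \<le> (\<Sum>k\<le>n. norm (of_real (cbin k * cbin (n - k)) * (1 / u\<^sup>2) ^ k))" by (rule norm_sum)
  also have "\<dots> = (\<Sum>k\<le>n. cbin k * cbin (n - k))"
    using cbin_pos by (intro sum.cong refl) (simp add: norm_mult norm_power norm_divide u less_imp_le)
  finally show ?thesis by (simp add: cbin_convolution)
qed

section \<open>Asymptotics of the remainder of a Cauchy kernel\<close>

definition cbin_series :: "complex \<Rightarrow> complex" where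
  "cbin_series s = (\<Sum>k. of_real (cbin k) * s ^ k)"

lemma cbin_series_summable: "norm (s :: complex) < 1 \<Longrightarrow> summable (\<lambda>k. norm (of_real (cbin k) * s ^ k))"
  by (rule summable_comparison_test'[OF summable_geometric[of "norm s"]])
     (auto simp: norm_mult norm_power cbin_pos less_imp_le cbin_le_1 intro!: mult_left_le_one_le)

text \<open>
  By the Cauchy product and \<open>cbin_convolution\<close> the square is the geometric series. Working with the square avoids
  choosing a branch of \<open>(1 - s) powr (-1/2)\<close>.
\<close>

lemma cbin_series_square:
  assumes "norm s < 1"
  shows "cbin_series s * cbin_series s = 1 / (1 - s)"
proof -
  have "cbin_series s * cbin_series s
    = (\<Sum>n. \<Sum>k\<le>n. of_real (cbin k) * s ^ k * (of_real (cbin (n - k)) * s ^ (n - k)))"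
    unfolding cbin_series_def using cbin_series_summable[OF assms] by (intro Cauchy_product)
  also have "\<dots> = (\<Sum>n. s ^ n)"
  proof (rule suminf_cong)
    fix n
    have "(\<Sum>k\<le>n. of_real (cbin k) * s ^ k * (of_real (cbin (n - k)) * s ^ (n - k))) = 
       (\<Sum>k\<le>n. of_real (cbin k * cbin (n - k)) * s ^ n)"
      by (intro sum.cong refl) (simp flip: power_add)
    also have "\<dots> = of_real (\<Sum>k\<le>n. cbin k * cbin (n - k)) * s ^ n"
      by (simp add: sum_distrib_right)
    finally show "(\<Sum>k\<le>n. of_real (cbin k) * s ^ k * (of_real (cbin (n - k)) * s ^ (n - k))) = s ^ n"
      by (simp add: cbin_convolution del: of_real_sum)
  qed
  finally show ?thesis using suminf_geometric[OF assms] by simp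
qed

text \<open>
  The value \<open>P\<^sub>n(z) / (g\<^sub>n u ^ n)\<close> as a function of \<open>s = 1 / u\<^sup>2\<close>.
\<close>

definition leg_scaled :: "nat \<Rightarrow> complex \<Rightarrow> complex" where
  "leg_scaled n s = (\<Sum>k\<le>n. of_real (cbin k * cbin (n - k) / cbin n) * s ^ k)"

lemma leg_eq_scaled:
  assumes "u \<noteq> 0"
  shows "poly (leg n) ((u + 1 / u) / 2) = of_real (cbin n) * u ^ n * leg_scaled n (1 / u\<^sup>2)"
proof -
  have "cbin n \<noteq> 0" using cbin_pos[of n] by simp
  then show ?thesis
    unfolding leg_expansion[OF assms] leg_scaled_def sum_distrib_left 
    by (intro sum.cong refl) simp
qed

text \<open>
  Tannery's theorem, applied to the sum of the errors \<open>\<bar>g\<^sub>k g\<^sub>n\<^sub>-\<^sub>k / g\<^sub>n - g\<^sub>k\<bar> * r ^ k\<close>, which does not involve \<open>s\<close>.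
  Each error tends to \<open>0\<close>, and it is at most \<open>r ^ k\<close> because both coefficients lie between \<open>0\<close> and \<open>1\<close>.
\<close>

lemma leg_scaled_uniform_limit:
  assumes r: "0 \<le> r" "r < 1"
  shows "uniform_limit (cball 0 r) leg_scaled cbin_series sequentially"
proof -
  define w where "w n k = (if k \<le> n then cbin k * cbin (n - k) / cbin n else 0)" for n k
  define a where "a k n = \<bar>w n k - cbin k\<bar> * r ^ k" for k n
  have w: "0 \<le> w n k" "w n k \<le> 1" for n k
    using cbin_mult_le[of k "n - k"] cbin_pos[of n] cbin_pos[of k] cbin_pos[of "n - k"]
      by (auto simp: w_def)
  have a: "0 \<le> a k n" "a k n \<le> r ^ k" for n k
  proof -
    have "\<bar>w n k - cbin k\<bar> \<le> 1" using w[of n k] cbin_pos[of k] cbin_le_1[of k] by linarith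
    then show "a k n \<le> r ^ k" using r by (auto simp: a_def intro: mult_left_le_one_le)
  qed (use r in \<open>simp add: a_def\<close>)
  have sum_a: "summable (\<lambda>k. a k n)" for n
    by (rule summable_comparison_test'[OF summable_geometric[of r]]) (use a r in auto)
  have "(\<lambda>n. \<Sum>k. a k n) \<longlonglongrightarrow> (\<Sum>k. 0)"
  proof (rule tannerys_theorem[THEN conjunct2, THEN conjunct2])
    fix k
    have "(\<lambda>n. w (n + k) k) \<longlonglongrightarrow> cbin k * 1"
      using tendsto_mult[OF tendsto_const cbin_ratio[of k], of "cbin k"] by (simp add: w_def)
    then have "(\<lambda>n. w n k) \<longlonglongrightarrow> cbin k * 1" by (rule LIMSEQ_offset)
    then have "(\<lambda>n. a k n) \<longlonglongrightarrow> \<bar>cbin k * 1 - cbin k\<bar> * r ^ k"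
      unfolding a_def by (intro tendsto_intros)
    then show "(\<lambda>n. a k n) \<longlonglongrightarrow> 0" by simp
  next
    show "\<forall>\<^sub>F (k, n) in at_top \<times>\<^sub>F sequentially. norm (a k n) \<le> r ^ k"
      using a by (intro always_eventually) auto
  qed (use r in auto)
  then have lim: "(\<lambda>n. \<Sum>k. a k n) \<longlonglongrightarrow> 0" by simp
  have bound: "dist (leg_scaled n s) (cbin_series s) \<le> (\<Sum>k. a k n)" if "s \<in> cball 0 r" for n s
  proof -
    have s: "norm s \<le> r" using that by simp
    have "(\<lambda>k. of_real (w n k) * s ^ k) sums (\<Sum>k\<le>n. of_real (w n k) * s ^ k)"
      by (rule sums_finite) (auto simp: w_def)
    then have "(\<lambda>k. of_real (w n k) * s ^ k) sums leg_scaled n s"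
      by (simp add: leg_scaled_def w_def)
    from sums_diff[OF this, of "\<lambda>k. of_real (cbin k) * s ^ k" "cbin_series s"]
    have sums: "(\<lambda>k. of_real (w n k - cbin k) * s ^ k) sums (leg_scaled n s - cbin_series s)"
      using summable_sums[OF summable_norm_cancel[OF cbin_series_summable[of s]]] s r
      by (simp add: cbin_series_def left_diff_distrib)
    have le: "norm (of_real (w n k - cbin k) * s ^ k) \<le> a k n" for k
      unfolding norm_mult norm_power norm_of_real a_def
        using s by (intro mult_left_mono power_mono) auto
    have "summable (\<lambda>k. norm (of_real (w n k - cbin k) * s ^ k))"
      by (rule summable_comparison_test'[OF sum_a[of n]]) (use le in auto)
    then have "norm (leg_scaled n s - cbin_series s) \<le> (\<Sum>k. norm (of_real (w n k - cbin k) * s ^ k))"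
      using summable_norm sums_unique[OF sums] by metis
    also have "\<dots> \<le> (\<Sum>k. a k n)"
      using le by (intro suminf_le sum_a \<open>summable (\<lambda>k. norm (of_real (w n k - cbin k) * s ^ k))\<close>)
    finally show ?thesis by (simp add: dist_norm)
  qed
  show ?thesis
  proof (rule uniform_limitI)
    fix e :: real assume "e > 0"
    then have "\<forall>\<^sub>F n in sequentially. (\<Sum>k. a k n) < e" using order_tendstoD(2)[OF lim] by blast
    then show "\<forall>\<^sub>F n in sequentially. \<forall>s\<in>cball 0 r. dist (leg_scaled n s) (cbin_series s) < e"
      by eventually_elim (use bound in \<open>meson le_less_trans\<close>)
  qed
qed

text \<open>
  The difference of two consecutive remainders, multiplied by \<open>u ^ (2 n + 1)\<close> and written in terms of \<open>s = 1 / u\<^sup>2\<close>.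
\<close>

definition scaled_gap :: "nat \<Rightarrow> complex \<Rightarrow> complex" where
  "scaled_gap n s = 2 / (of_real (real (Suc n) * cbin n * cbin (Suc n))
    * (leg_scaled n s * leg_scaled (Suc n) s))"

text \<open>
  Both factors \<open>leg_scaled\<close> tend to the same series, whose square is \<open>1 / (1 - s)\<close>; the constant \<open>\<pi>\<close> enters through
  Wallis' product.
\<close>

lemma scaled_gap_uniform_limit:
  assumes r: "0 \<le> r" "r < 1"
  shows "uniform_limit (cball 0 r) scaled_gap (\<lambda>s. of_real (2 * pi) * (1 - s)) sequentially"
proof -
  let ?C = "cball (0 :: complex) r"
  have sq: "cbin_series s * cbin_series s = 1 / (1 - s)" and s1: "1 - s \<noteq> 0"
    and low: "1 / 2 \<le> norm (1 / (1 - s))" and up: "norm (1 / (1 - s)) \<le> 1 / (1 - r)" if "s \<in> ?C" for s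
  proof -
    have s: "norm s \<le> r" "norm s < 1" using that r by auto
    show "cbin_series s * cbin_series s = 1 / (1 - s)" by (rule cbin_series_square[OF s(2)])
    show "1 - s \<noteq> 0" using s by auto
    have "norm (1 - s) \<le> 2" using norm_triangle_ineq4[of 1 s] s by simp
    then show "1 / 2 \<le> norm (1 / (1 - s))" using \<open>1 - s \<noteq> 0\<close> by (simp add: norm_divide field_simps)
    have "norm (1 - s) \<ge> 1 - r" using norm_triangle_ineq2[of 1 s] s by simp
    then show "norm (1 / (1 - s)) \<le> 1 / (1 - r)" using r by (simp add: norm_divide frac_le)
  qed
  have b1: "bounded (cbin_series ` ?C)"
  proof -
    have "norm (cbin_series s) \<le> 1 + 1 / (1 - r)" if "s \<in> ?C" for s
    proof -
      have "norm (cbin_series s) * norm (cbin_series s) \<le> 1 / (1 - r)"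
        using up[OF that] sq[OF that] by (simp flip: norm_mult)
      moreover have "norm (cbin_series s) \<le> 1 + norm (cbin_series s) * norm (cbin_series s)"
        using zero_le_power2[of "norm (cbin_series s) - 1 / 2"]
          by (simp add: power2_eq_square algebra_simps)
      ultimately show ?thesis by linarith
    qed
    then show ?thesis by (auto simp: bounded_iff intro!: exI[of _ "1 + 1 / (1 - r)"])
  qed
  note u1 = leg_scaled_uniform_limit[OF r]
  have u2: "uniform_limit ?C (\<lambda>n. leg_scaled (Suc n)) cbin_series sequentially"
    using u1 unfolding uniform_limit_sequentially_iff by (meson le_Suc_eq le_trans)
  have u3: "uniform_limit ?C (\<lambda>n s. leg_scaled n s * leg_scaled (Suc n) s) (\<lambda>s. 1 / (1 - s))
    sequentially"
    using uniform_lim_mult[OF u1 u2 b1 b1]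
      by (rule uniform_limit_cong'[THEN iffD1, rotated -1]) (auto simp: sq)
  have "(\<lambda>n. complex_of_real (real (Suc n) * cbin n * cbin (Suc n))) \<longlonglongrightarrow> of_real (1 / pi)"
    by (intro tendsto_intros cbin_wallis)
  then have u4: "uniform_limit ?C (\<lambda>n s. complex_of_real (real (Suc n) * cbin n * cbin (Suc n)))
    (\<lambda>s. of_real (1 / pi)) sequentially"
    unfolding uniform_limit_iff tendsto_iff by (auto elim: eventually_mono)
  have "bounded ((\<lambda>s. 1 / (1 - s)) ` ?C)"
    using up by (auto simp: bounded_iff intro!: exI[of _ "1 / (1 - r)"])
  then have u5: "uniform_limit ?C
    (\<lambda>n s. of_real (real (Suc n) * cbin n * cbin (Suc n)) * (leg_scaled n s * leg_scaled (Suc n) s)) 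
     (\<lambda>s. of_real (1 / pi) * (1 / (1 - s))) sequentially"
    by (intro uniform_lim_mult u4 u3) (auto simp: bounded_iff)
  have "uniform_limit ?C scaled_gap (\<lambda>s. 2 / (of_real (1 / pi) * (1 / (1 - s)))) sequentially"
    unfolding scaled_gap_def
  proof (rule uniform_lim_divide[OF uniform_limit_const u5])
    show "1 / (2 * pi) \<le> norm (complex_of_real (1 / pi) * (1 / (1 - s)))" if "s \<in> ?C" for s
    proof -
      have "1 / (2 * pi) = 1 / pi * (1 / 2)" by simp
      also have "\<dots> \<le> 1 / pi * norm (1 / (1 - s))"
        using low[OF that] by (intro mult_left_mono) auto
      also have "1 / pi = norm (complex_of_real (1 / pi))" unfolding norm_of_real by simp
      finally show ?thesis unfolding norm_mult .
    qed
  qed (auto simp: bounded_iff)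
  then show ?thesis
    by (rule uniform_limit_cong'[THEN iffD1, rotated -1]) (use s1 in \<open>auto simp: field_simps\<close>)
qed

lemma cauchy_rem_scaled_gap:
  assumes u: "norm u > 1" and z: "z = (u + 1 / u) / 2" "Im z > 0"
  shows "cauchy_rem n z * u ^ (2 * n + 1)
    = scaled_gap n (1 / u\<^sup>2) + 1 / u\<^sup>2 * (cauchy_rem (Suc n) z * u ^ (2 * Suc n + 1))"
proof -
  have u0: "u \<noteq> 0" using u by auto
  have "cauchy_rem n z * u ^ (2 * n + 1) = 
     2 * u ^ (2 * n + 1) / (of_nat (Suc n) * poly (leg n) z * poly (leg (Suc n)) z)
       + cauchy_rem (Suc n) z * u ^ (2 * n + 1)"
    using cauchy_rem_step[OF z(2), of n] by (simp add: algebra_simps)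
  also have "2 * u ^ (2 * n + 1) / (of_nat (Suc n) * poly (leg n) z * poly (leg (Suc n)) z)
    = scaled_gap n (1 / u\<^sup>2)"
  proof -
    define D where "D = of_real (real (Suc n) * cbin n * cbin (Suc n)) *
      (leg_scaled n (1 / u\<^sup>2) * leg_scaled (Suc n) (1 / u\<^sup>2))"
    have "of_nat (Suc n) * poly (leg n) z * poly (leg (Suc n)) z = u ^ (2 * n + 1) * D"
      unfolding z(1) leg_eq_scaled[OF u0] D_def
      by (simp add: power_add mult_2 mult_2_right mult_ac del: of_nat_Suc cbin.simps)
    moreover have "u ^ (2 * n + 1) \<noteq> 0" using u0 by simp
    ultimately have "2 * u ^ (2 * n + 1) / (of_nat (Suc n) * poly (leg n) z * poly (leg (Suc n)) z)
      = 2 / D"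
      by (simp del: power_Suc)
    then show ?thesis unfolding scaled_gap_def D_def .
  qed
  also have "cauchy_rem (Suc n) z * u ^ (2 * n + 1)
    = 1 / u\<^sup>2 * (cauchy_rem (Suc n) z * u ^ (2 * Suc n + 1))"
    using u0 by (simp add: power2_eq_square field_simps)
  finally show ?thesis .
qed

text \<open>
  A crude lower bound, enough to make \<open>g\<^sub>n \<bar>u\<bar> ^ n\<close> grow exponentially.
\<close>

lemma cbin_ge: "cbin n \<ge> 1 / real (Suc n)"
proof (induction n)
  case (Suc n)
  have "1 / real (Suc (Suc n)) \<le> 1 / real (Suc n) * ((2 * real n + 1) / (2 * real n + 2))"
    by (simp add: divide_simps) (simp add: algebra_simps)
  also have "\<dots> \<le> cbin n * ((2 * real n + 1) / (2 * real n + 2))"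
    by (intro mult_right_mono Suc) simp
  finally show ?case by simp
qed simp

lemma cauchy_rem_tendsto_0:
  assumes u: "norm u > 1" and z: "z = (u + 1 / u) / 2" "Im z > 0"
  shows "(\<lambda>n. cauchy_rem n z) \<longlonglongrightarrow> 0"
proof -
  have u0: "u \<noteq> 0" using u by auto
  define s where "s = 1 / u\<^sup>2"
  have s: "norm s < 1" using one_less_power[OF u, of 2]
    by (simp add: s_def norm_divide norm_power divide_less_eq)
  define c where "c = norm (cbin_series s) / 2"
  have "cbin_series s \<noteq> 0" using cbin_series_square[OF s] s by auto
  then have c: "c > 0" by (simp add: c_def)
  have "(\<lambda>n. leg_scaled n s) \<longlonglongrightarrow> cbin_series s"
    using leg_scaled_uniform_limit[OF norm_ge_zero s] by (rule tendsto_uniform_limitI) simp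
  then have "(\<lambda>n. norm (leg_scaled n s)) \<longlonglongrightarrow> norm (cbin_series s)" by (rule tendsto_norm)
  then have ev: "\<forall>\<^sub>F n in sequentially. norm (leg_scaled n s) > c"
    by (rule order_tendstoD) (use c in \<open>simp add: c_def\<close>)
  have "\<forall>\<^sub>F n in sequentially. norm (cauchy_rem n z) \<le> (2 / Im z / c) * (real (Suc n) / norm u ^ n)"
    using ev
  proof eventually_elim
    case (elim n)
    have "norm (integral {-1..1} (\<lambda>x. poly (leg n) (of_real x) / (z - of_real x)))
      \<le> 1 / Im z * (1 - (- 1))"
    proof (rule integral_bound)
      show "continuous_on {- 1..1} (\<lambda>x. poly (leg n) (of_real x) / (z - complex_of_real x))"
        using upper_neq_real[OF z(2)] by (intro continuous_intros) auto
      show "norm (poly (leg n) (of_real x) / (z - of_real x)) \<le> 1 / Im z" if "x \<in> {-1..1}" for x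
      proof -
        have "Im z \<le> norm (z - of_real x)" using abs_Im_le_cmod[of "z - of_real x"] z(2) by simp
        then show ?thesis unfolding norm_divide
          using norm_leg_le_1[OF that, of n] z(2) by (intro frac_le) auto
      qed
    qed simp
    moreover have "norm u ^ n / real (Suc n) * c \<le> norm (poly (leg n) z)"
    proof -
      have "norm u ^ n / real (Suc n) * c = 1 / real (Suc n) * norm u ^ n * c" by simp
      also have "\<dots> \<le> cbin n * norm u ^ n * norm (leg_scaled n s)"
        using cbin_ge[of n] cbin_pos[of n] elim c by (intro mult_mono) (auto simp del: of_nat_Suc)
      finally show ?thesis
        unfolding z(1) leg_eq_scaled[OF u0] norm_mult s_def[symmetric]
          by (simp add: norm_power cbin_pos less_imp_le)
    qed
    ultimately have "norm (cauchy_rem n z) \<le> (2 / Im z) / (norm u ^ n / real (Suc n) * c)"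
      unfolding cauchy_rem_eq_second_kind[OF z(2)] norm_divide
        using c u0 z(2) by (intro frac_le) (auto simp del: of_nat_Suc)
    then show ?case by (simp add: field_simps)
  qed
  moreover have "(\<lambda>n. (2 / Im z / c) * (real (Suc n) / norm u ^ n)) \<longlonglongrightarrow> 0"
  proof (rule tendsto_mult_right_zero)
    show "(\<lambda>n. real (Suc n) / norm u ^ n) \<longlonglongrightarrow> 0"
    proof -
      have "(\<lambda>n. real n * (1 / norm u) ^ n) \<longlonglongrightarrow> 0"
        by (rule powser_times_n_limit_0) (use u in \<open>simp add: divide_less_eq\<close>)
      from tendsto_mult_left[OF LIMSEQ_Suc[OF this], of "norm u"] show ?thesis
        using u0 by (simp add: power_divide)
    qed
  qed
  ultimately show ?thesis by (rule Lim_null_comparison)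
qed

text \<open>
  Iterating the recursion writes \<open>d n\<close> as a geometric sum of the errors plus a remainder that is assumed to vanish
  in the limit.
\<close>

lemma geometric_recursion_bound:
  fixes d e :: "nat \<Rightarrow> complex"
  assumes rec: "\<And>n. d n = e n + s * d (Suc n)" and e: "\<And>m. m \<ge> n \<Longrightarrow> norm (e m) \<le> \<epsilon>"
    and s: "norm s \<le> r" "r < 1" and lim: "(\<lambda>J. s ^ J * d (n + J)) \<longlonglongrightarrow> 0"
  shows "norm (d n) \<le> \<epsilon> / (1 - r)"
proof -
  have r: "0 \<le> r" using s norm_ge_zero[of s] by linarith
  have \<epsilon>: "0 \<le> \<epsilon>" using e[of n] norm_ge_zero[of "e n"] by linarith
  have eq: "d n = (\<Sum>j<J. s ^ j * e (n + j)) + s ^ J * d (n + J)" for J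
  proof (induction J)
    case (Suc J)
    then show ?case using rec[of "n + J"] by (simp add: algebra_simps)
  qed simp
  have "norm (d n) \<le> \<epsilon> / (1 - r) + norm (s ^ J * d (n + J))" for J
  proof -
    have "norm (\<Sum>j<J. s ^ j * e (n + j)) \<le> (\<Sum>j<J. r ^ j * \<epsilon>)"
      using s e by (intro sum_norm_le)
        (auto simp: norm_mult norm_power intro!: mult_mono power_mono zero_le_power r)
    also have "\<dots> = \<epsilon> * (\<Sum>j<J. r ^ j)" by (simp add: sum_distrib_left mult.commute)
    also have "\<dots> \<le> \<epsilon> * (1 / (1 - r))"
      using r s \<epsilon> by (intro mult_left_mono) (auto simp: sum_gp_strict divide_right_mono)
    finally show ?thesis using norm_triangle_ineq[of "\<Sum>j<J. s ^ j * e (n + j)" "s ^ J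
      * d (n + J)"] eq[of J] by simp
  qed
  moreover have "(\<lambda>J. \<epsilon> / (1 - r) + norm (s ^ J * d (n + J))) \<longlonglongrightarrow> \<epsilon> / (1 - r) + 0"
    using tendsto_norm[OF lim] by (intro tendsto_intros) simp
  ultimately show ?thesis by (intro LIMSEQ_le_const[of _ "\<epsilon> / (1 - r)"]) auto
qed

text \<open>
  Put \<open>d\<^sub>n = K\<^sub>n u ^ (2 n + 1) - 2 \<pi>\<close>. The constant \<open>2 \<pi>\<close> is the fixed point of \<open>h \<mapsto> 2 \<pi> (1 - s) + s h\<close>, the limit of
  the recursion \<open>cauchy_rem_scaled_gap\<close>, so \<open>d\<^sub>n\<close> obeys a geometric recursion with ratio \<open>s\<close> and uniformly small errors.
\<close>

lemma cauchy_rem_uniform_limit: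
  assumes \<rho>: "\<rho> > 1"
    and \<phi>: "\<And>z. z \<in> S \<Longrightarrow> Im z > 0 \<and> norm (\<phi> z) \<ge> \<rho> \<and> z = (\<phi> z + 1 / \<phi> z) / 2"
  shows "uniform_limit S (\<lambda>n z. cauchy_rem n z * \<phi> z ^ (2 * n + 1)) (\<lambda>z. of_real (2 * pi)) sequentially"
proof -
  define r where "r = 1 / \<rho>\<^sup>2"
  have r: "0 \<le> r" "r < 1" using \<rho> by (auto simp: r_def)
  have s: "norm (1 / (\<phi> z)\<^sup>2) \<le> r" if "z \<in> S" for z
    using \<phi>[OF that] \<rho> unfolding r_def norm_divide norm_power by (intro frac_le power_mono) auto
  show ?thesis
  proof (rule uniform_limitI)
    fix e :: real assume e: "e > 0"
    define e' where "e' = e / 2 * (1 - r)"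
    have "e' > 0" using e r by (simp add: e'_def)
    from uniform_limitD[OF scaled_gap_uniform_limit[OF r] this]
    obtain N where N: "\<And>m s. m \<ge> N \<Longrightarrow> s \<in> cball 0 r
      \<Longrightarrow> dist (scaled_gap m s) (of_real (2 * pi) * (1 - s)) < e'"
      unfolding eventually_sequentially by blast
    show "\<forall>\<^sub>F n in sequentially. \<forall>z\<in>S. dist (cauchy_rem n z * \<phi> z ^ (2 * n + 1)) (of_real (2 * pi)) < e"
      unfolding eventually_sequentially
    proof (intro exI[of _ N] allI impI ballI)
      fix n z assume n: "N \<le> n" and z: "z \<in> S"
      define u where "u = \<phi> z"
      have u: "norm u > 1" "z = (u + 1 / u) / 2" "Im z > 0" using \<phi>[OF z] \<rho> by (auto simp: u_def)
      have u0: "u \<noteq> 0" using u by auto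
      define s where "s = 1 / u\<^sup>2"
      have sr: "norm s \<le> r" using s[OF z] by (simp add: s_def u_def)
      define d where "d m = cauchy_rem m z * u ^ (2 * m + 1) - of_real (2 * pi)" for m
      have "norm (d n) \<le> e' / (1 - r)"
      proof (rule geometric_recursion_bound)
        show "d m = (scaled_gap m s - of_real (2 * pi) * (1 - s)) + s * d (Suc m)" for m
          unfolding d_def cauchy_rem_scaled_gap[OF u, of m] s_def[symmetric]
            by (simp only: algebra_simps) simp
        show "norm (scaled_gap m s - of_real (2 * pi) * (1 - s)) \<le> e'" if "m \<ge> n" for m
          using N[of m s] that n sr by (simp add: dist_norm)
        show "norm s \<le> r" "r < 1" by fact+
        have "(\<lambda>J. cauchy_rem (J + n) z) \<longlonglongrightarrow> 0"
          using cauchy_rem_tendsto_0[OF u] by (rule LIMSEQ_ignore_initial_segment)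
        then have "(\<lambda>J. u ^ (2 * n + 1) * cauchy_rem (J + n) z - of_real (2 * pi) * s ^ J)
          \<longlonglongrightarrow> u ^ (2 * n + 1) * 0 - of_real (2 * pi) * 0"
          using sr r by (intro tendsto_intros LIMSEQ_power_zero) auto
        moreover have "s ^ J * d (n + J)
          = u ^ (2 * n + 1) * cauchy_rem (J + n) z - of_real (2 * pi) * s ^ J" for J
        proof -
          have "s ^ J * u ^ (2 * (n + J) + 1) = u ^ (2 * n + 1)"
          proof -
            have "u ^ (2 * (n + J) + 1) = u ^ (2 * n + 1) * (u\<^sup>2) ^ J"
              unfolding power_mult[symmetric] power_add[symmetric]
                by (rule arg_cong[of _ _ "power u"]) simp
            then show ?thesis using u0 by (simp add: s_def power_divide)
          qed
          then show ?thesis by (simp add: d_def algebra_simps del: power_Suc)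
        qed
        ultimately show "(\<lambda>J. s ^ J * d (n + J)) \<longlonglongrightarrow> 0" by simp
      qed
      also have "e' / (1 - r) = e / 2"
        unfolding e'_def by (rule nonzero_mult_div_cancel_right) (use r in simp)
      also have "\<dots> < e" using e by simp
      finally show "dist (cauchy_rem n z * \<phi> z ^ (2 * n + 1)) (of_real (2 * pi)) < e"
        by (simp add: d_def u_def dist_norm)
    qed
  qed
qed

section \<open>The exterior Joukowski variable on the upper half-plane\<close>

definition upper_half :: "complex set" where "upper_half = {z. Im z > 0}"

lemma open_upper_half: "open upper_half"
  unfolding upper_half_def by (rule open_halfspace_Im_gt)

lemma upper_half_not_segment: "z \<in> upper_half \<Longrightarrow> z \<notin> complex_of_real ` {-1..1}"
  by (auto simp: upper_half_def)

text \<open>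
  Both \<open>z\<close> and \<open>w = \<i> * csqrt (1 - z\<^sup>2)\<close> lie in the upper half-plane, hence so does \<open>u = z + w\<close>. Since
  \<open>2 * Im z = Im u * (1 - 1 / \<bar>u\<bar>\<^sup>2)\<close> is positive, \<open>\<bar>u\<bar> > 1\<close>, which identifies the branch.
\<close>

lemma sqrt_branch_upper_half:
  assumes "z \<in> upper_half"
  shows "sqrt_branch z = \<i> * csqrt (1 - z\<^sup>2)" and "1 - z\<^sup>2 \<notin> \<real>\<^sub>\<le>\<^sub>0"
proof -
  have z: "Im z > 0" using assms by (simp add: upper_half_def)
  show nonpos: "1 - z\<^sup>2 \<notin> \<real>\<^sub>\<le>\<^sub>0"
  proof
    assume "1 - z\<^sup>2 \<in> \<real>\<^sub>\<le>\<^sub>0"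
    then have "Re (1 - z\<^sup>2) \<le> 0" "Im (1 - z\<^sup>2) = 0"
      by (auto simp: complex_nonpos_Reals_iff)
    then have "Re z = 0" and "1 \<le> (Re z)\<^sup>2 - (Im z)\<^sup>2" using z by (auto simp: power2_eq_square)
    then have "(Im z)\<^sup>2 \<le> - 1" by simp
    then show False using zero_le_power2[of "Im z"] by linarith
  qed
  define w where "w = \<i> * csqrt (1 - z\<^sup>2)"
  define u where "u = z + w"
  have "Re (csqrt (1 - z\<^sup>2)) > 0"
  proof (rule ccontr)
    define c where "c = csqrt (1 - z\<^sup>2)"
    assume "\<not> Re (csqrt (1 - z\<^sup>2)) > 0"
    then have "Re c = 0" using csqrt_principal[of "1 - z\<^sup>2"] by (auto simp: c_def)
    then have "c\<^sup>2 \<in> \<real>\<^sub>\<le>\<^sub>0" by (simp add: complex_nonpos_Reals_iff power2_eq_square)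
    then show False using nonpos by (simp add: c_def)
  qed
  then have "Im w > 0" by (simp add: w_def)
  have w2: "w\<^sup>2 = z\<^sup>2 - 1" by (simp add: w_def power_mult_distrib)
  have "Im u > 0" using z \<open>Im w > 0\<close> by (simp add: u_def)
  then have "u \<noteq> 0" by auto
  have "u * (z - w) = 1" using w2 by (simp add: u_def algebra_simps power2_eq_square)
  then have "z - w = 1 / u" using \<open>u \<noteq> 0\<close> by (simp add: field_simps)
  then have "2 * z = u + 1 / u" unfolding u_def by (simp add: algebra_simps)
  then have "2 * Im z = Im (u + 1 / u)" by (metis Im_complex_of_real mult_2 plus_complex.simps(2))
  also have "\<dots> = Im u - Im u / (norm u)\<^sup>2" by (simp add: Im_divide cmod_power2)
  also have "\<dots> = Im u * (1 - 1 / (norm u)\<^sup>2)" by (simp add: field_simps)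
  finally have "1 - 1 / (norm u)\<^sup>2 > 0"
    using z \<open>Im u > 0\<close> by (metis mult_pos_pos zero_less_mult_pos zero_less_numeral)
  then have "1 < (norm u)\<^sup>2" using \<open>u \<noteq> 0\<close> by (simp add: field_simps)
  then have "norm u > 1" by (metis norm_ge_zero power2_less_imp_less power_one)
  then show "sqrt_branch z = \<i> * csqrt (1 - z\<^sup>2)"
    using ex1_sqrt_branch[OF upper_half_not_segment[OF assms]]
      sqrt_branch[OF upper_half_not_segment[OF assms]] w2
    unfolding u_def w_def by blast
qed

definition \<phi> :: "complex \<Rightarrow> complex" where "\<phi> z = z + sqrt_branch z"

text \<open>
  The inverse branch of the Joukowski map \<open>u \<mapsto> (u + 1/u) / 2\<close> with values outside the unit disc, and its logarithmic
  derivative \<open>1 / \<surd>(z\<^sup>2 - 1)\<close>.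
\<close>

lemma \<phi>_upper_half:
  assumes "z \<in> upper_half"
  shows "norm (\<phi> z) > 1" "z = (\<phi> z + 1 / \<phi> z) / 2" "sqrt_branch z \<noteq> 0"
    "(\<phi> has_field_derivative \<phi> z / sqrt_branch z) (at z)"
proof -
  define w where "w = sqrt_branch z"
  have w2: "w\<^sup>2 = z\<^sup>2 - 1" and n: "norm (z + w) > 1"
    using sqrt_branch[OF upper_half_not_segment[OF assms]] by (auto simp: w_def)
  show "norm (\<phi> z) > 1" using n by (simp add: \<phi>_def w_def)
  have "\<phi> z \<noteq> 0" using n by (auto simp: \<phi>_def w_def)
  moreover have "\<phi> z * (z - w) = 1" using w2 by (simp add: \<phi>_def w_def algebra_simps power2_eq_square)
  ultimately have "z - w = 1 / \<phi> z" by (simp add: field_simps)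
  then show "z = (\<phi> z + 1 / \<phi> z) / 2" by (simp add: \<phi>_def w_def field_simps)
  have w: "w = \<i> * csqrt (1 - z\<^sup>2)" using sqrt_branch_upper_half(1)[OF assms] by (simp add: w_def)
  show w0: "sqrt_branch z \<noteq> 0" using sqrt_branch_upper_half[OF assms] by auto
  have "((\<lambda>z. z + \<i> * csqrt (1 - z\<^sup>2))
    has_field_derivative (1 + \<i> * (- (2 * z) * (inverse (2 * csqrt (1 - z\<^sup>2)))))) (at z)"
  proof -
    have "((\<lambda>z. 1 - z\<^sup>2) has_field_derivative - (2 * z)) (at z)"
      by (auto intro!: derivative_eq_intros)
    from DERIV_chain2[OF has_field_derivative_csqrt[OF sqrt_branch_upper_half(2)[OF assms]] this]
    show ?thesis by (intro DERIV_add DERIV_ident DERIV_cmult) (simp add: mult.commute)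
  qed
  moreover have "\<forall>\<^sub>F x in nhds z. z \<in> upper_half \<and> x + \<i> * csqrt (1 - x\<^sup>2) = \<phi> x"
    using eventually_nhds_in_open[OF open_upper_half assms] 
    by eventually_elim (use assms in \<open>auto simp: \<phi>_def sqrt_branch_upper_half\<close>)
  then have ev: "\<forall>\<^sub>F x in nhds z. x + \<i> * csqrt (1 - x\<^sup>2) = \<phi> x" by eventually_elim auto
  ultimately have "(\<phi> has_field_derivative (1
    + \<i> * (- (2 * z) * (inverse (2 * csqrt (1 - z\<^sup>2)))))) (at z)"
    using DERIV_cong_ev[OF refl ev refl] by blast
  moreover have "1 + \<i> * (- (2 * z) * (inverse (2 * csqrt (1 - z\<^sup>2)))) = \<phi> z / sqrt_branch z"
  proof -
    have "csqrt (1 - z\<^sup>2) = - \<i> * w" using w by simp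
    then show ?thesis using w0 unfolding \<phi>_def w_def[symmetric] by (simp add: field_simps)
  qed
  ultimately show "(\<phi> has_field_derivative \<phi> z / sqrt_branch z) (at z)" by simp
qed

section \<open>Poles of higher order\<close>

text \<open>
  The exponent is \<open>k + 1\<close>, so that \<open>k\<close> counts derivatives of the kernel with respect to \<open>z\<close>.
\<close>

definition pow_rem :: "nat \<Rightarrow> nat \<Rightarrow> complex \<Rightarrow> complex" where
  "pow_rem k n z = gl_remainder n (\<lambda>x. inverse ((of_real x - z) ^ Suc k))"

lemma pow_rem_0: "pow_rem 0 n z = - cauchy_rem n z"
proof -
  have "(\<lambda>x. inverse (complex_of_real x - z)) = (\<lambda>x. - (1 / (z - of_real x)))"
    by (metis (no_types) inverse_eq_divide minus_diff_eq nonzero_minus_divide_right divide_minus_right)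
  then show ?thesis by (simp add: pow_rem_def cauchy_rem_def gl_remainder_def gl_rule_def sum_negf)
qed

lemma has_field_derivative_inverse_power:
  assumes "z \<in> upper_half"
  shows "((\<lambda>z. inverse ((of_real x - z) ^ Suc k)) has_field_derivative
    of_nat (Suc k) * inverse ((of_real x - z) ^ Suc (Suc k))) (at z within S)"
proof -
  have "of_real x - z \<noteq> 0" using assms by (auto simp: upper_half_def complex_eq_iff)
  then have "((\<lambda>z. inverse (of_real x - z))
    has_field_derivative (inverse (of_real x - z))\<^sup>2) (at z within S)"
    by (auto intro!: derivative_eq_intros simp: power2_eq_square)
  from DERIV_power[OF this, of "Suc k"] show ?thesis
    by (simp add: power_inverse power2_eq_square mult_ac del: of_nat_Suc)
qed

lemma pow_rem_has_derivative:
  assumes z: "z \<in> upper_half"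
  shows "(pow_rem k n has_field_derivative of_nat (Suc k) * pow_rem (Suc k) n z) (at z)"
proof -
  have nz: "of_real x - w \<noteq> 0"
    if "w \<in> upper_half" for w x using that by (auto simp: upper_half_def complex_eq_iff)
  have "((\<lambda>z. integral (cbox (-1) 1) (\<lambda>x::real. inverse ((of_real x - z) ^ Suc k))) has_field_derivative
      integral (cbox (-1) 1) (\<lambda>x::real. of_nat (Suc k)
        * inverse ((of_real x - z) ^ Suc (Suc k)))) (at z within upper_half)"
  proof (rule leibniz_rule_field_derivative[OF has_field_derivative_inverse_power])
    show "(\<lambda>x::real. inverse ((of_real x - w) ^ Suc k)) integrable_on cbox (-1) 1"
      if "w \<in> upper_half" for w
      using nz[OF that] by (intro integrable_continuous continuous_intros) auto
    show "continuous_on (upper_half \<times> cbox (-1) 1)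
      (\<lambda>(w, x::real). of_nat (Suc k) * inverse ((of_real x - w) ^ Suc (Suc k)))"
      unfolding case_prod_unfold using nz by (intro continuous_intros) auto
    show "convex upper_half" unfolding upper_half_def by (rule convex_halfspace_Im_gt)
  qed (use z in auto)
  then have "((\<lambda>z. integral {-1..1} (\<lambda>x::real. inverse ((of_real x - z) ^ Suc k))) has_field_derivative
      of_nat (Suc k) * integral {-1..1} (\<lambda>x::real. inverse ((of_real x - z) ^ Suc (Suc k)))) (at z)"
    using at_within_open[OF z open_upper_half] by (simp only: integral_mult_right cbox_interval)
  moreover have "((\<lambda>z. gl_rule n (\<lambda>x. inverse ((of_real x - z) ^ Suc k))) has_field_derivative
      of_nat (Suc k) * gl_rule n (\<lambda>x. inverse ((of_real x - z) ^ Suc (Suc k)))) (at z)"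
    unfolding gl_rule_def sum_distrib_left mult.assoc[symmetric]
    by (intro DERIV_sum DERIV_cmult_right has_field_derivative_inverse_power z)
  ultimately show ?thesis
    unfolding pow_rem_def gl_remainder_def right_diff_distrib by (rule DERIV_diff)
qed

text \<open>
  The functions \<open>f n\<close> are eventually bounded on a compact neighbourhood of \<open>C\<close>, so Cauchy's inequality bounds
  their derivatives on \<open>C\<close> uniformly in \<open>n\<close>.
\<close>

lemma uniform_limit_deriv_over_n:
  fixes f :: "nat \<Rightarrow> complex \<Rightarrow> complex"
  assumes S: "open S" and hol: "\<And>n. f n holomorphic_on S" and g: "g holomorphic_on S"
    and lim: "\<And>C. compact C \<Longrightarrow> C \<subseteq> S \<Longrightarrow> uniform_limit C f g sequentially"
    and C: "compact C" "C \<subseteq> S"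
  shows "uniform_limit C (\<lambda>n z. deriv (f n) z / of_nat (2 * n + 1)) (\<lambda>_. 0) sequentially"
proof -
  obtain e where e: "e > 0" "(\<Union>z\<in>C. cball z e) \<subseteq> S"
    using compact_subset_open_imp_cball_epsilon_subset[OF C(1) S C(2)] by blast
  define D where "D = (\<Union>z\<in>C. cball z e)"
  have "compact D" unfolding D_def using compact_minkowski_sum_cball[OF C(1)] by simp
  have "D \<subseteq> S" using e by (simp add: D_def)
  have "bounded (g ` D)"
    using compact_imp_bounded[OF compact_continuous_image[OF _ \<open>compact D\<close>]] 
      continuous_on_subset[OF holomorphic_on_imp_continuous_on[OF g] \<open>D \<subseteq> S\<close>] by blast
  then obtain B where B: "\<And>w. w \<in> D \<Longrightarrow> norm (g w) \<le> B" by (auto simp: bounded_iff)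
  have "\<forall>\<^sub>F n in sequentially. \<forall>w\<in>D. dist (f n w) (g w) < 1"
    using lim[OF \<open>compact D\<close> \<open>D \<subseteq> S\<close>] by (rule uniform_limitD) simp
  then have ev: "\<forall>\<^sub>F n in sequentially. \<forall>z\<in>C. norm (deriv (f n) z / of_nat (2 * n + 1))
    \<le> (B + 1) / e / real (2 * n + 1)"
  proof eventually_elim
    case (elim n)
    show ?case
    proof
      fix z assume z: "z \<in> C"
      have "norm ((deriv ^^ 1) (f n) z) \<le> fact 1 * (B + 1) / e ^ 1"
      proof (rule Cauchy_inequality)
        have sub: "cball z e \<subseteq> S" using e z by auto
        show "f n holomorphic_on ball z e"
          using hol sub ball_subset_cball by (meson holomorphic_on_subset order_trans)
        show "continuous_on (cball z e) (f n)" using hol sub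
          by (meson holomorphic_on_imp_continuous_on holomorphic_on_subset)
        show "norm (f n x) \<le> B + 1" if "norm (z - x) = e" for x
        proof -
          have x: "x \<in> D" unfolding D_def using z that by (auto simp: dist_norm)
          then have "norm (f n x - g x) < 1" using elim by (simp add: dist_norm)
          then show ?thesis using B[OF x] norm_triangle_sub[of "f n x" "g x"] by linarith
        qed
      qed (use e in auto)
      then show "norm (deriv (f n) z / of_nat (2 * n + 1)) \<le> (B + 1) / e / real (2 * n + 1)"
        unfolding norm_divide norm_of_nat by (intro divide_right_mono) auto
    qed
  qed
  moreover have "uniform_limit C (\<lambda>n z. (B + 1) / e / real (2 * n + 1)) (\<lambda>_. 0) sequentially"
  proof -
    have "(\<lambda>n. (B + 1) / e / real (2 * n + 1)) \<longlonglongrightarrow> 0" by real_asymp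
    then show ?thesis unfolding uniform_limit_iff tendsto_iff by (auto elim: eventually_mono)
  qed
  ultimately show ?thesis by (rule uniform_limit_null_comparison)
qed

text \<open>
  The derivative of order \<open>k\<close> of the remainder for \<open>1 / (x - z)\<close>, normalised so that it has a finite nonzero limit.
\<close>

definition scaled_pow_rem :: "nat \<Rightarrow> nat \<Rightarrow> complex \<Rightarrow> complex" where
  "scaled_pow_rem k n z = fact k * pow_rem k n z * \<phi> z ^ (2 * n + 1) / of_nat (2 * n + 1) ^ k"

text \<open>
  One more derivative of the remainder, expressed through normalised quantities. The second summand is the derivative
  of the power of \<open>\<phi>\<close>, with \<open>\<phi>' = \<phi> / \<surd>(z\<^sup>2 - 1)\<close>.
\<close>

lemma scaled_pow_rem_has_derivative:
  assumes "z \<in> upper_half"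
  shows "(scaled_pow_rem k n has_field_derivative
    of_nat (2 * n + 1) * (scaled_pow_rem (Suc k) n z
      + scaled_pow_rem k n z * (1 / sqrt_branch z))) (at z)"
proof -
  define N where "N = 2 * n + 1"
  have N: "of_nat N \<noteq> (0 :: complex)" by (simp only: of_nat_eq_0_iff N_def)
  have "((\<lambda>z. \<phi> z ^ N)
    has_field_derivative of_nat N * (\<phi> z / sqrt_branch z * \<phi> z ^ (N - Suc 0))) (at z)"
    by (rule DERIV_power[OF \<phi>_upper_half(4)[OF assms]])
  also have "\<phi> z / sqrt_branch z * \<phi> z ^ (N - Suc 0) = \<phi> z ^ N * (1 / sqrt_branch z)"
    by (simp add: N_def)
  finally have P: "((\<lambda>z. \<phi> z ^ N)
    has_field_derivative of_nat N * (\<phi> z ^ N * (1 / sqrt_branch z))) (at z)" .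
  have "((\<lambda>z. fact k * pow_rem k n z * \<phi> z ^ N / of_nat N ^ k) has_field_derivative
     (fact k * (of_nat (Suc k) * pow_rem (Suc k) n z) * \<phi> z ^ N
       + of_nat N * (\<phi> z ^ N * (1 / sqrt_branch z)) * (fact k * pow_rem k n z)) / of_nat N ^ k) (at z)"
    by (intro DERIV_cdivide DERIV_mult DERIV_cmult pow_rem_has_derivative assms P)
  also have "(fact k * (of_nat (Suc k) * pow_rem (Suc k) n z) * \<phi> z ^ N
    + of_nat N * (\<phi> z ^ N * (1 / sqrt_branch z)) * (fact k * pow_rem k n z)) / of_nat N ^ k
     = of_nat N * (fact (Suc k) * pow_rem (Suc k) n z * \<phi> z ^ N / of_nat N ^ Suc k
       + fact k * pow_rem k n z * \<phi> z ^ N / of_nat N ^ k * (1 / sqrt_branch z))"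
    using N by (simp add: ring_distribs add_divide_distrib mult_ac)
  finally show ?thesis unfolding scaled_pow_rem_def N_def .
qed

lemma sqrt_branch_holomorphic: "sqrt_branch holomorphic_on upper_half"
proof -
  have "\<phi> holomorphic_on upper_half"
    using \<phi>_upper_half(4) open_upper_half by (auto simp: holomorphic_on_open)
  then have "(\<lambda>z. \<phi> z - z) holomorphic_on upper_half" by (intro holomorphic_intros)
  then show ?thesis by (simp add: \<phi>_def)
qed

text \<open>
  Solving \<open>scaled_pow_rem_has_derivative\<close> for the function with index \<open>k + 1\<close>, the derivative term
  is divided by \<open>2 n + 1\<close> and disappears in the limit; what remains multiplies the limit by \<open>- 1 / \<surd>(z\<^sup>2 - 1)\<close>.
  Convergence on all compact sets is what the induction needs, since derivatives are controlled from a neighbourhood.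
\<close>

lemma scaled_pow_rem_uniform_limit:
  assumes "compact C" "C \<subseteq> upper_half"
  shows "uniform_limit C (scaled_pow_rem k) (\<lambda>z. - of_real (2 * pi) * (- 1 / sqrt_branch z) ^ k)
    sequentially"
  using assms
proof (induction k arbitrary: C)
  case 0
  show ?case
  proof (cases "C = {}")
    case False
    have "continuous_on C (\<lambda>z. norm (\<phi> z))"
      using \<phi>_upper_half(4) 0(2)
        by (intro continuous_on_norm continuous_at_imp_continuous_on ballI DERIV_isCont) blast
    then obtain z1 where z1: "z1 \<in> C" "\<And>z. z \<in> C \<Longrightarrow> norm (\<phi> z1) \<le> norm (\<phi> z)"
      using continuous_attains_inf[OF 0(1) False] by blast
    have "norm (\<phi> z1) > 1" using z1 0 \<phi>_upper_half(1) by blast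
    then have "uniform_limit C (\<lambda>n z. cauchy_rem n z * \<phi> z ^ (2 * n + 1)) (\<lambda>z. of_real (2 * pi))
      sequentially"
      by (rule cauchy_rem_uniform_limit) (use z1 0 \<phi>_upper_half(2) in \<open>auto simp: upper_half_def\<close>)
    then have "uniform_limit C (\<lambda>n z. - (cauchy_rem n z * \<phi> z ^ (2 * n + 1))) (\<lambda>z. - of_real (2 * pi))
      sequentially"
      by (rule uniform_limit_intros)
    then show ?thesis by (simp add: scaled_pow_rem_def[abs_def] pow_rem_0)
  qed simp
next
  case (Suc k)
  let ?g = "\<lambda>z. - of_real (2 * pi) * (- 1 / sqrt_branch z) ^ k"
  have w0: "sqrt_branch z \<noteq> 0" if "z \<in> upper_half" for z using \<phi>_upper_half(3)[OF that] .
  have g: "?g holomorphic_on upper_half"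
    using w0 by (intro holomorphic_intros sqrt_branch_holomorphic) auto
  have w: "(\<lambda>z. 1 / sqrt_branch z) holomorphic_on upper_half"
    using w0 by (intro holomorphic_intros sqrt_branch_holomorphic) auto
  have bdd: "bounded (h ` C)" if "h holomorphic_on upper_half" for h :: "complex \<Rightarrow> complex"
    using that Suc.prems 
    by (meson compact_continuous_image compact_imp_bounded continuous_on_subset
      holomorphic_on_imp_continuous_on)
  have "uniform_limit C (\<lambda>n z. deriv (scaled_pow_rem k n) z / of_nat (2 * n + 1)) (\<lambda>_. 0) sequentially"
    by (rule uniform_limit_deriv_over_n[OF open_upper_half _ g Suc.IH Suc.prems])
       (use scaled_pow_rem_has_derivative open_upper_half in \<open>auto simp: holomorphic_on_open\<close>)
  moreover have "uniform_limit C (\<lambda>n z. scaled_pow_rem k n z * (1 / sqrt_branch z))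
    (\<lambda>z. ?g z * (1 / sqrt_branch z)) sequentially"
    by (intro uniform_lim_mult Suc.IH Suc.prems uniform_limit_const bdd g w)
  ultimately have "uniform_limit C
    (\<lambda>n z. deriv (scaled_pow_rem k n) z / of_nat (2 * n + 1)
      - scaled_pow_rem k n z * (1 / sqrt_branch z))
     (\<lambda>z. 0 - ?g z * (1 / sqrt_branch z)) sequentially"
    by (rule uniform_limit_minus)
  moreover have "deriv (scaled_pow_rem k n) z / of_nat (2 * n + 1)
    - scaled_pow_rem k n z * (1 / sqrt_branch z) = scaled_pow_rem (Suc k) n z"
    if "z \<in> C" for n z
  proof -
    have "z \<in> upper_half" using that Suc.prems by blast
    moreover have "of_nat (2 * n + 1) \<noteq> (0 :: complex)" by (simp only: of_nat_eq_0_iff)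
    ultimately show ?thesis
      unfolding DERIV_imp_deriv[OF scaled_pow_rem_has_derivative[OF \<open>z \<in> upper_half\<close>]]
      by (subst nonzero_mult_div_cancel_left) auto
  qed
  moreover have "0 - ?g z * (1 / sqrt_branch z) = - of_real (2 * pi) * (- 1 / sqrt_branch z) ^ Suc k"
    for z
    by simp
  ultimately show ?case
    by (subst (asm) uniform_limit_cong') 
qed

theorem theorem1:
  fixes p :: nat and a b :: real and z0 :: complex and f :: "real \<Rightarrow> complex"
  assumes "p \<ge> 1" and "b > 0"
  defines "z0 \<equiv> Complex a b"
    and "f \<equiv> (\<lambda>x. (of_real x - z0) powi (- int p))"
  shows "(\<lambda>n. norm (gl_remainder n f)) \<sim>[at_top]
    (\<lambda>n. 2 * pi / fact (p - 1)
        * norm (of_nat (2 * n + 1) / sqrt_branch z0) ^ (p - 1)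
        * (1 / norm (z0 + sqrt_branch z0) ^ (2 * n + 1)))"
proof -
  define k where "k = p - 1"
  have p: "p = Suc k" using assms(1) by (simp add: k_def)
  have z0: "z0 \<in> upper_half" using assms(2) by (simp add: z0_def upper_half_def)
  define w where "w = sqrt_branch z0"
  have w0: "w \<noteq> 0" and u: "norm (\<phi> z0) > 1" using \<phi>_upper_half[OF z0] by (auto simp: w_def)
  have f: "f = (\<lambda>x. inverse ((of_real x - z0) ^ Suc k))"
    unfolding f_def p power_int_minus power_int_of_nat ..
  have "(\<lambda>n. scaled_pow_rem k n z0) \<longlonglongrightarrow> - of_real (2 * pi) * (- 1 / w) ^ k"
    using scaled_pow_rem_uniform_limit[of "{z0}" k] z0 by (simp add: w_def)
  then have "(\<lambda>n. norm (scaled_pow_rem k n z0) * (norm w ^ k / (2 * pi))) \<longlonglongrightarrow> 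
      norm (- of_real (2 * pi) * (- 1 / w) ^ k) * (norm w ^ k / (2 * pi))"
    by (intro tendsto_intros)
  also have "norm (- of_real (2 * pi) * (- 1 / w) ^ k) * (norm w ^ k / (2 * pi)) = 1"
    using w0 by (simp add: norm_mult norm_power norm_divide power_divide)
  finally have lim: "(\<lambda>n. norm (scaled_pow_rem k n z0) * (norm w ^ k / (2 * pi))) \<longlonglongrightarrow> 1" .
  show ?thesis
  proof (rule asymp_equivI', rule Lim_transform_eventually[OF lim], intro always_eventually allI)
    fix n
    have R: "gl_remainder n f = pow_rem k n z0" by (simp only: pow_rem_def f)
    have "norm (scaled_pow_rem k n z0)
      = fact k * norm (pow_rem k n z0) * norm (\<phi> z0) ^ (2 * n + 1) / real (2 * n + 1) ^ k"
      unfolding scaled_pow_rem_def norm_mult norm_divide norm_power norm_of_nat by simp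
    moreover have "norm (\<phi> z0) ^ (2 * n + 1) \<noteq> 0" "real (2 * n + 1) ^ k \<noteq> 0" "norm w \<noteq> 0"
      using u w0 by auto
    ultimately show "norm (scaled_pow_rem k n z0) * (norm w ^ k / (2 * pi)) = norm (gl_remainder n f) /
        (2 * pi / fact (p - 1) * norm (of_nat (2 * n + 1) / sqrt_branch z0) ^ (p - 1)
        * (1 / norm (z0 + sqrt_branch z0) ^ (2 * n + 1)))"
      unfolding R k_def[symmetric] w_def[symmetric] \<phi>_def[of z0, folded w_def, symmetric] norm_divide
        norm_of_nat
      by (simp add: power_divide field_simps del: power_Suc of_nat_add of_nat_mult)
  qed
qed

end
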